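(* Let $p$ be a separable permutation and let $f:[\mathbb{N}]^2\to 2$ be a computable coloring which avoids $p$. Then every $\emptyset'$-DNC Turing degree computes an infinite $f$-homogeneous set.
   Context: $[\mathbb{N}]^2$ is the set of pairs $x<y$ of naturals. A pattern of size $\ell$ is a function $p:[\ell]^2\to2$; a permutation $\pi$ of $\{0,\dots,\ell-1\}$ is identified with the pattern $p_\pi(x,y)=0$ if $\pi(x)<\pi(y)$ and $1$ otherwise ($x<y$). A finite set $\{x_0<\dots<x_{\ell-1}\}$ $f$-realizes $p$ if $f(x_i,x_j)=p(i,j)$ for all $i<j$; $f$ avoids $p$ if no finite subset of $\mathbb{N}$ $f$-realizes $p$. A set $H$ is $f$-homogeneous if $f$ is constant on pairs from $H$. Direct sum: $(\pi\oplus\sigma)(x)=\pi(x)$ for $x<m$, $\sigma(x-m)+m$ for $m\le x<m+n$; skew sum: $(\pi\ominus\sigma)(x)=\pi(x)+n$ for $x<m$, $\sigma(x-m)$ for $m\le x<m+n$ (with $m,n$ the sizes of $\pi,\sigma$). A permutation is separable if it is obtained from the one-element permutation by direct and skew sums. A function $g:\mathbb{N}\to\mathbb{N}$ is $\emptyset'$-DNC if $g(e)\neq\Phi^{\emptyset'}_e(e)$ for every $e$ (where defined); a Turing degree is $\emptyset'$-DNC if it bounds a $\emptyset'$-DNC function. *)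

theory Defs
  imports Main "HOL-Library.Nat_Bijection" "HOL-Library.FuncSet" "HOL-Combinatorics.Permutations"
begin

section \<open>Oracle computability\<close>

text \<open>
  Programs for the functions that are partial recursive relative to an oracle set, as unary
  functions on the naturals; tuples are passed through the pairing function \<^const>\<open>prod_encode\<close>.
\<close>

datatype program =
    Zero
  | Succ
  | Fst
  | Snd
  | Query
  | Tuple program program
  | Comp program program
  | Prec program program
  | Mu program

text \<open>
  \<open>Query\<close> asks the oracle. On input \<open>(a, n)\<close>, \<open>Prec c d\<close> iterates
  \<open>h 0 = c a\<close>, \<open>h (m + 1) = d (a, (m, h m))\<close> up to \<open>h n\<close>. On input \<open>a\<close>, \<open>Mu c\<close> searches for the
  least \<open>n\<close> with \<open>c (a, n) = 0\<close>, and diverges if an earlier value of \<open>c\<close> does.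
\<close>

primrec run :: "nat set \<Rightarrow> program \<Rightarrow> nat \<rightharpoonup> nat" where
  "run A Zero = (\<lambda>x. Some 0)"
| "run A Succ = (\<lambda>x. Some (Suc x))"
| "run A Fst = (\<lambda>x. Some (fst (prod_decode x)))"
| "run A Snd = (\<lambda>x. Some (snd (prod_decode x)))"
| "run A Query = (\<lambda>x. Some (of_bool (x \<in> A)))"
| "run A (Tuple c d) = (\<lambda>x. case (run A c x, run A d x) of
      (Some u, Some v) \<Rightarrow> Some (prod_encode (u, v)) | _ \<Rightarrow> None)"
| "run A (Comp c d) = (\<lambda>x. Option.bind (run A d x) (run A c))"
| "run A (Prec c d) = (\<lambda>x. case prod_decode x of (a, n) \<Rightarrow>
      rec_nat (run A c a)
        (\<lambda>m r. Option.bind r (\<lambda>v. run A d (prod_encode (a, prod_encode (m, v))))) n)"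
| "run A (Mu c) = (\<lambda>a.
      if \<exists>n. run A c (prod_encode (a, n)) = Some 0 \<and>
             (\<forall>m<n. run A c (prod_encode (a, m)) \<noteq> None)
      then Some (LEAST n. run A c (prod_encode (a, n)) = Some 0)
      else None)"

text \<open>The effective numbering of programs is given by its inverse, an explicit bijective coding.\<close>

primrec program_code :: "program \<Rightarrow> nat" where
  "program_code Zero = 0"
| "program_code Succ = 1"
| "program_code Fst = 2"
| "program_code Snd = 3"
| "program_code Query = 4"
| "program_code (Tuple c d) = 5 + 4 * prod_encode (program_code c, program_code d)"
| "program_code (Comp c d) = 6 + 4 * prod_encode (program_code c, program_code d)"
| "program_code (Prec c d) = 7 + 4 * prod_encode (program_code c, program_code d)"
| "program_code (Mu c) = 8 + 4 * program_code c"

lemma inj_program_code: "inj program_code"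
proof (rule injI)
  fix c d assume "program_code c = program_code d"
  then show "c = d"
  proof (induction c arbitrary: d)
    case Zero then show ?case by (cases d) auto
  next
    case Succ then show ?case by (cases d) auto
  next
    case Fst then show ?case by (cases d) auto
  next
    case Snd then show ?case by (cases d) auto
  next
    case Query then show ?case by (cases d) auto
  next
    case (Tuple c1 c2) then show ?case by (cases d; simp; presburger)
  next
    case (Comp c1 c2) then show ?case by (cases d; simp; presburger)
  next
    case (Prec c1 c2) then show ?case by (cases d; simp; presburger)
  next
    case (Mu c) then show ?case by (cases d; simp; presburger)
  qed
qed

lemma surj_program_code: "surj program_code"
proof -
  have "\<exists>c. program_code c = n" for n
  proof (induction n rule: less_induct)
    case (less n)
    consider "n = 0" | "n = 1" | "n = 2" | "n = 3" | "n = 4" | "n \<ge> 5" by linarith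
    then show ?case
    proof cases
      assume "n \<ge> 5"
      define k where "k = (n - 5) div 4"
      obtain a b where ab: "prod_decode k = (a, b)" by (cases "prod_decode k")
      then have k: "k = prod_encode (a, b)" by (metis prod_decode_inverse)
      have "k < n" using \<open>n \<ge> 5\<close> by (simp add: k_def)
      then have "a < n" "b < n"
        using k le_prod_encode_1[of a b] le_prod_encode_2[of b a] by linarith+
      then obtain ca cb ck where
        "program_code ca = a" "program_code cb = b" "program_code ck = k"
        using less \<open>k < n\<close> by metis
      moreover have "n = 5 + 4 * k \<or> n = 6 + 4 * k \<or> n = 7 + 4 * k \<or> n = 8 + 4 * k"
        using \<open>n \<ge> 5\<close> unfolding k_def by presburger
      ultimately show ?thesis
        using k program_code.simps(6-9) by metis
    qed (metis program_code.simps)+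
  qed
  then show ?thesis by (metis surjI)
qed

definition program_of :: "nat \<Rightarrow> program" where
  "program_of = inv program_code"

lemma program_of_code [simp]: "program_of (program_code c) = c"
  by (simp add: program_of_def inj_program_code)

lemma code_program_of [simp]: "program_code (program_of e) = e"
  by (simp add: program_of_def surj_program_code surj_f_inv_f)

definition Phi :: "nat set \<Rightarrow> nat \<Rightarrow> nat \<rightharpoonup> nat" where
  "Phi A e = run A (program_of e)"

definition jump :: "nat set \<Rightarrow> nat set" where
  "jump A = {e. Phi A e e \<noteq> None}"

definition computable_from :: "nat set \<Rightarrow> (nat \<Rightarrow> nat) \<Rightarrow> bool" where
  "computable_from A g \<longleftrightarrow> (\<exists>e. \<forall>x. Phi A e x = Some (g x))"

definition turing_le :: "nat set \<Rightarrow> nat set \<Rightarrow> bool" (infix "\<le>\<^sub>T" 50) where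
  "B \<le>\<^sub>T A \<longleftrightarrow> computable_from A (\<lambda>x. of_bool (x \<in> B))"

primrec plug :: "program \<Rightarrow> program \<Rightarrow> program" where
  "plug q Zero = Zero"
| "plug q Succ = Succ"
| "plug q Fst = Fst"
| "plug q Snd = Snd"
| "plug q Query = q"
| "plug q (Tuple c d) = Tuple (plug q c) (plug q d)"
| "plug q (Comp c d) = Comp (plug q c) (plug q d)"
| "plug q (Prec c d) = Prec (plug q c) (plug q d)"
| "plug q (Mu c) = Mu (plug q c)"

lemma run_plug:
  assumes "\<And>x. run A q x = Some (of_bool (x \<in> B))"
  shows "run A (plug q c) = run B c"
  by (induction c) (simp_all add: assms cong: if_cong)

lemma computable_from_trans:
  assumes "computable_from B g" "B \<le>\<^sub>T A"
  shows "computable_from A g"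
  using assms run_plug unfolding computable_from_def turing_le_def Phi_def
  by (metis program_of_code)

lemma turing_le_refl: "A \<le>\<^sub>T A"
  unfolding turing_le_def computable_from_def Phi_def
  by (rule exI[of _ "program_code Query"]) (simp del: program_code.simps)

definition turing_equiv :: "(nat set \<times> nat set) set" where
  "turing_equiv = {(A, B). A \<le>\<^sub>T B \<and> B \<le>\<^sub>T A}"

lemma equiv_turing_equiv: "equiv UNIV turing_equiv"
  unfolding turing_equiv_def
  by (intro equivI refl_onI symI transI)
    (auto simp: turing_le_refl, (meson turing_le_def computable_from_trans)+)

definition turing_degrees :: "nat set set set" where
  "turing_degrees = UNIV // turing_equiv"

definition degree_computes :: "nat set set \<Rightarrow> (nat \<Rightarrow> nat) \<Rightarrow> bool" where
  "degree_computes d g \<longleftrightarrow> (\<exists>A\<in>d. computable_from A g)"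

lemma degree_computes_iff:
  assumes "d \<in> turing_degrees" "A \<in> d"
  shows "degree_computes d g \<longleftrightarrow> computable_from A g"
proof
  assume "degree_computes d g"
  then obtain B where B: "B \<in> d" "computable_from B g"
    unfolding degree_computes_def by blast
  have "(B, A) \<in> turing_equiv"
    using assms B(1) equiv_turing_equiv unfolding turing_degrees_def
    by (meson quotient_eq_iff)
  then show "computable_from A g"
    using B(2) computable_from_trans unfolding turing_equiv_def by blast
qed (use assms(2) in \<open>auto simp: degree_computes_def\<close>)

definition degree_computes_set :: "nat set set \<Rightarrow> nat set \<Rightarrow> bool" where
  "degree_computes_set d H \<longleftrightarrow> degree_computes d (\<lambda>x. of_bool (x \<in> H))"

definition DNC :: "nat set \<Rightarrow> (nat \<Rightarrow> nat) \<Rightarrow> bool" where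
  "DNC A g \<longleftrightarrow> (\<forall>e v. Phi A e e = Some v \<longrightarrow> g e \<noteq> v)"

definition DNC_degree :: "nat set \<Rightarrow> nat set set \<Rightarrow> bool" where
  "DNC_degree A d \<longleftrightarrow> (\<exists>g. DNC A g \<and> degree_computes d g)"


section \<open>Colorings and patterns\<close>

definition pairs :: "nat set \<Rightarrow> (nat \<times> nat) set" where
  "pairs X = {(x, y). x \<in> X \<and> y \<in> X \<and> x < y}"

text \<open>Colorings and patterns are total functions whose values outside \<open>pairs X\<close> are irrelevant.\<close>

definition computable_coloring :: "(nat \<times> nat \<Rightarrow> nat) \<Rightarrow> bool" where
  "computable_coloring f \<longleftrightarrow> f \<in> pairs UNIV \<rightarrow> {..<2} \<and>
     (\<exists>e. \<forall>z\<in>pairs UNIV. Phi {} e (prod_encode z) = Some (f z))"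

definition homogeneous :: "(nat \<times> nat \<Rightarrow> nat) \<Rightarrow> nat set \<Rightarrow> bool" where
  "homogeneous f H \<longleftrightarrow> (\<exists>c. \<forall>z\<in>pairs H. f z = c)"

definition realizes ::
    "(nat \<times> nat \<Rightarrow> nat) \<Rightarrow> nat \<Rightarrow> (nat \<times> nat \<Rightarrow> nat) \<Rightarrow> nat set \<Rightarrow> bool" where
  "realizes f l p F \<longleftrightarrow> finite F \<and> card F = l \<and>
     (\<forall>(i, j)\<in>pairs {..<l}. f (sorted_list_of_set F ! i, sorted_list_of_set F ! j) = p (i, j))"

definition avoids :: "(nat \<times> nat \<Rightarrow> nat) \<Rightarrow> nat \<Rightarrow> (nat \<times> nat \<Rightarrow> nat) \<Rightarrow> bool" where
  "avoids f l p \<longleftrightarrow> \<not> (\<exists>F. realizes f l p F)"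

definition perm_pattern :: "(nat \<Rightarrow> nat) \<Rightarrow> nat \<times> nat \<Rightarrow> nat" where
  "perm_pattern \<pi> = (\<lambda>(x, y). if \<pi> x < \<pi> y then 0 else 1)"

text \<open>
  A permutation of \<open>{0, \<dots>, l - 1}\<close> is a function \<open>\<pi>\<close> with \<open>\<pi> permutes {..<l}\<close>, hence the identity
  from \<open>l\<close> on.
\<close>

definition direct_sum :: "nat \<Rightarrow> (nat \<Rightarrow> nat) \<Rightarrow> nat \<Rightarrow> (nat \<Rightarrow> nat) \<Rightarrow> nat \<Rightarrow> nat" where
  "direct_sum m \<pi> n \<sigma> = (\<lambda>x.
     if x < m then \<pi> x else if x < m + n then \<sigma> (x - m) + m else x)"

definition skew_sum :: "nat \<Rightarrow> (nat \<Rightarrow> nat) \<Rightarrow> nat \<Rightarrow> (nat \<Rightarrow> nat) \<Rightarrow> nat \<Rightarrow> nat" where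
  "skew_sum m \<pi> n \<sigma> = (\<lambda>x.
     if x < m then \<pi> x + n else if x < m + n then \<sigma> (x - m) else x)"

inductive separable :: "nat \<Rightarrow> (nat \<Rightarrow> nat) \<Rightarrow> bool" where
  one: "separable 1 id"
| direct: "separable m \<pi> \<Longrightarrow> separable n \<sigma> \<Longrightarrow> separable (m + n) (direct_sum m \<pi> n \<sigma>)"
| skew: "separable m \<pi> \<Longrightarrow> separable n \<sigma> \<Longrightarrow> separable (m + n) (skew_sum m \<pi> n \<sigma>)"

lemma permutes_lessThanI:
  fixes \<pi> :: "nat \<Rightarrow> nat"
  assumes "\<And>x. x < l \<Longrightarrow> \<pi> x < l" "inj_on \<pi> {..<l}" "\<And>x. x \<ge> l \<Longrightarrow> \<pi> x = x"
  shows "\<pi> permutes {..<l}"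
proof (rule bij_imp_permutes)
  have "\<pi> ` {..<l} = {..<l}"
    using assms(1,2) by (intro endo_inj_surj) auto
  then show "bij_betw \<pi> {..<l} {..<l}"
    using assms(2) by (simp add: bij_betw_def)
qed (use assms(3) in auto)

lemma permutes_lessThan_less:
  fixes \<pi> :: "nat \<Rightarrow> nat"
  assumes "\<pi> permutes {..<l}" "x < l"
  shows "\<pi> x < l"
  using assms permutes_in_image[of \<pi> "{..<l}" x] by simp

lemma permutes_direct_sum:
  assumes "\<pi> permutes {..<m}" "\<sigma> permutes {..<n}"
  shows "direct_sum m \<pi> n \<sigma> permutes {..<m + n}"
proof (rule permutes_lessThanI)
  have \<pi>: "\<pi> x < m" if "x < m" for x using permutes_lessThan_less[OF assms(1) that] .
  have \<sigma>: "\<sigma> x < n" if "x < n" for x using permutes_lessThan_less[OF assms(2) that] .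
  show "direct_sum m \<pi> n \<sigma> x < m + n" if "x < m + n" for x
    using that \<pi>[of x] \<sigma>[of "x - m"] by (auto simp: direct_sum_def)
  show "inj_on (direct_sum m \<pi> n \<sigma>) {..<m + n}"
  proof (rule inj_onI)
    fix x y assume "x \<in> {..<m + n}" "y \<in> {..<m + n}" "direct_sum m \<pi> n \<sigma> x = direct_sum m \<pi> n \<sigma> y"
    then show "x = y"
      using \<pi>[of x] \<pi>[of y] permutes_inj[OF assms(1)] permutes_inj[OF assms(2)]
      by (auto simp: direct_sum_def inj_eq split: if_splits)
  qed
qed (auto simp: direct_sum_def)

lemma permutes_skew_sum:
  assumes "\<pi> permutes {..<m}" "\<sigma> permutes {..<n}"
  shows "skew_sum m \<pi> n \<sigma> permutes {..<m + n}"
proof (rule permutes_lessThanI)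
  have \<pi>: "\<pi> x < m" if "x < m" for x using permutes_lessThan_less[OF assms(1) that] .
  have \<sigma>: "\<sigma> (x - m) < n" if "x < m + n" "\<not> x < m" for x
    using that permutes_lessThan_less[OF assms(2), of "x - m"] by simp
  show "skew_sum m \<pi> n \<sigma> x < m + n" if "x < m + n" for x
    using that \<pi>[of x] \<sigma>[of x] by (auto simp: skew_sum_def intro: trans_less_add2)
  show "inj_on (skew_sum m \<pi> n \<sigma>) {..<m + n}"
  proof (rule inj_onI)
    fix x y assume "x \<in> {..<m + n}" "y \<in> {..<m + n}" "skew_sum m \<pi> n \<sigma> x = skew_sum m \<pi> n \<sigma> y"
    then show "x = y"
      using \<sigma>[of x] \<sigma>[of y] permutes_inj[OF assms(1)] permutes_inj[OF assms(2)]
      by (auto simp: skew_sum_def inj_eq split: if_splits)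
  qed
qed (auto simp: skew_sum_def)

lemma separable_permutes: "separable l \<pi> \<Longrightarrow> \<pi> permutes {..<l}"
  by (induction rule: separable.induct)
    (use permutes_id in \<open>auto simp: permutes_direct_sum permutes_skew_sum simp del: id_apply\<close>)

end

theory Submission
  imports Defs "HOL-Library.Infinite_Set"
begin

text \<open>
  A coloring avoiding a separable permutation has no deep alternating sums of finite sets, so just
  below the minimal depth missing somewhere there are a computable reservoir, a color \<open>e\<close> and a number \<open>N\<close> such that
  arbitrarily wide alternating sums (nests) occur in every computable infinite part of the reservoir,
  while no nest of width \<open>N\<close> consists of elements with only finitely many \<open>e\<close>-neighbours in such a part.

  A DNC function relative to the jump chooses, before the nest is known, a path through a wide nest
  whose end has infinitely many \<open>e\<close>-neighbours; this works as soon as the width exceeds the numbers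
  chosen. If nests wide enough can always be recognised by waiting for an event to be enumerated, an
  infinite homogeneous set is built greedily. Otherwise the numbers chosen bound the stage at which
  any event can occur, so the enumerable events are decidable from the DNC function. Applied first to
  \<open>\<Sigma>\<^sub>1\<close> questions and then, relative to these, to the \<open>\<Sigma>\<^sub>2\<close> question whether an element has finitely
  many \<open>e\<close>-neighbours, this either yields a homogeneous set or makes the direct greedy construction
  effective.
\<close>

section \<open>Computable functions\<close>

abbreviation p1 :: "nat \<Rightarrow> nat" where "p1 z \<equiv> fst (prod_decode z)"
abbreviation p2 :: "nat \<Rightarrow> nat" where "p2 z \<equiv> snd (prod_decode z)"
abbreviation pr :: "nat \<Rightarrow> nat \<Rightarrow> nat" where "pr x y \<equiv> prod_encode (x, y)"

lemma computable_from_iff: "computable_from A h \<longleftrightarrow> (\<exists>q. run A q = (\<lambda>x. Some (h x)))"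
  unfolding computable_from_def Phi_def by (metis program_of_code)

lemma cf_comp:
  assumes "computable_from A h" "computable_from A k"
  shows "computable_from A (\<lambda>x. h (k x))"
proof -
  obtain q r where "run A q = (\<lambda>x. Some (h x))" "run A r = (\<lambda>x. Some (k x))"
    using assms by (auto simp: computable_from_iff)
  then show ?thesis unfolding computable_from_iff by (intro exI[of _ "Comp q r"]) auto
qed

lemma cf_fst: "computable_from A h \<Longrightarrow> computable_from A (\<lambda>x. p1 (h x))"
  by (rule cf_comp) (auto simp: computable_from_iff intro: exI[of _ Fst])

lemma cf_snd: "computable_from A h \<Longrightarrow> computable_from A (\<lambda>x. p2 (h x))"
  by (rule cf_comp) (auto simp: computable_from_iff intro: exI[of _ Snd])

lemma cf_Suc: "computable_from A h \<Longrightarrow> computable_from A (\<lambda>x. Suc (h x))"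
  by (rule cf_comp) (auto simp: computable_from_iff intro: exI[of _ Succ])

lemma cf_pair:
  assumes "computable_from A h" "computable_from A k"
  shows "computable_from A (\<lambda>x. pr (h x) (k x))"
proof -
  obtain q r where "run A q = (\<lambda>x. Some (h x))" "run A r = (\<lambda>x. Some (k x))"
    using assms by (auto simp: computable_from_iff)
  then show ?thesis unfolding computable_from_iff by (intro exI[of _ "Tuple q r"]) auto
qed

lemma cf_id: "computable_from A (\<lambda>x. x)"
  \<comment> \<open>The identity is not primitive; splitting and re-pairing returns the input
    because the pairing function is bijective.\<close>
  unfolding computable_from_iff by (intro exI[of _ "Tuple Fst Snd"]) auto

primrec const_program :: "nat \<Rightarrow> program" where
  "const_program 0 = Zero"
| "const_program (Suc n) = Comp Succ (const_program n)"

lemma run_const_program [simp]: "run A (const_program n) = (\<lambda>x. Some n)"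
  by (induction n) auto

lemma cf_const: "computable_from A (\<lambda>x. c)"
  unfolding computable_from_iff by (intro exI[of _ "const_program c"]) simp

lemma cf_comp2:
  assumes "computable_from A (\<lambda>z. h (p1 z) (p2 z))" "computable_from A a" "computable_from A b"
  shows "computable_from A (\<lambda>x. h (a x) (b x))"
  using cf_comp[OF assms(1) cf_pair[OF assms(2,3)]] by simp

lemma cf_rec:
  assumes "computable_from A c" "computable_from A (\<lambda>z. d (p1 z) (p1 (p2 z)) (p2 (p2 z)))"
    "computable_from A n"
  shows "computable_from A (\<lambda>x. rec_nat (c x) (d x) (n x))"
proof -
  obtain q r where q: "run A q = (\<lambda>x. Some (c x))"
    and r: "run A r = (\<lambda>z. Some (d (p1 z) (p1 (p2 z)) (p2 (p2 z))))"
    using assms by (auto simp: computable_from_iff)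
  \<comment> \<open>Since \<open>c\<close> and \<open>d\<close> are total, the option-valued
    recursion of \<open>Prec\<close> never diverges.\<close>
  have *: "rec_nat (Some (c a)) (\<lambda>m v. Option.bind v (\<lambda>v. Some (d a m v))) k = Some (rec_nat (c a) (d a) k)"
    for a k by (induction k) auto
  have "computable_from A (\<lambda>z. rec_nat (c (p1 z)) (d (p1 z)) (p2 z))"
    unfolding computable_from_iff
    by (rule exI[of _ "Prec q r"]) (auto simp: q r * split: prod.split)
  from cf_comp2[OF this cf_id assms(3)] show ?thesis .
qed

lemmas cf_basic = cf_const cf_id cf_fst cf_snd cf_Suc cf_pair

lemma cf_add:
  assumes "computable_from A a" "computable_from A b"
  shows "computable_from A (\<lambda>x. a x + b x)"
proof -
  have *: "rec_nat m (\<lambda>_ r. Suc r) n = m + n" for m n :: nat by (induction n) auto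
  have "computable_from A (\<lambda>x. rec_nat (a x) (\<lambda>_ r. Suc r) (b x))"
    by (rule cf_rec) (intro cf_basic assms)+
  then show ?thesis unfolding * .
qed

lemma cf_diff:
  assumes "computable_from A a" "computable_from A b"
  shows "computable_from A (\<lambda>x. a x - b x)"
proof -
  have 1: "rec_nat 0 (\<lambda>m _. m) n = n - 1" for n :: nat by (induction n) auto
  have "computable_from A (\<lambda>x. rec_nat 0 (\<lambda>m _. m) x)"
    by (rule cf_rec) (intro cf_basic)+
  then have pred: "computable_from A (\<lambda>x. x - 1)" unfolding 1 .
  have 2: "rec_nat m (\<lambda>_ r. r - 1) n = m - n" for m n :: nat by (induction n) auto
  have "computable_from A (\<lambda>x. rec_nat (a x) (\<lambda>_ r. r - 1) (b x))"
    by (rule cf_rec) (intro cf_basic assms cf_comp[OF pred])+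
  then show ?thesis unfolding 2 .
qed

lemma cf_mult:
  assumes "computable_from A a" "computable_from A b"
  shows "computable_from A (\<lambda>x. a x * b x)"
proof -
  have *: "rec_nat 0 (\<lambda>_ r. m + r) n = m * n" for m n :: nat by (induction n) auto
  have "computable_from A (\<lambda>x. rec_nat 0 (\<lambda>_ r. a x + r) (b x))"
    by (rule cf_rec) (intro cf_basic assms cf_add cf_comp[OF assms(1)])+
  then show ?thesis unfolding * .
qed

section \<open>Decidable predicates and bounded quantifiers\<close>

abbreviation decidable_from :: "nat set \<Rightarrow> (nat \<Rightarrow> bool) \<Rightarrow> bool" where
  "decidable_from A P \<equiv> computable_from A (\<lambda>x. of_bool (P x))"

lemma dec_comp: "decidable_from A P \<Longrightarrow> computable_from A k \<Longrightarrow> decidable_from A (\<lambda>x. P (k x))"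
  by (rule cf_comp)

lemma dec_comp2:
  "decidable_from A (\<lambda>z. P (p1 z) (p2 z)) \<Longrightarrow> computable_from A a \<Longrightarrow> computable_from A b
    \<Longrightarrow> decidable_from A (\<lambda>x. P (a x) (b x))"
  using cf_comp2[of A "\<lambda>x y. of_bool (P x y)"] .

lemma dec_not:
  assumes "decidable_from A P"
  shows "decidable_from A (\<lambda>x. \<not> P x)"
proof -
  have *: "of_bool (\<not> b) = (1 :: nat) - of_bool b" for b by simp
  show ?thesis unfolding * by (intro cf_diff cf_const assms)
qed

lemma dec_and:
  "decidable_from A P \<Longrightarrow> decidable_from A Q \<Longrightarrow> decidable_from A (\<lambda>x. P x \<and> Q x)"
  using cf_mult[of A "\<lambda>x. of_bool (P x)" "\<lambda>x. of_bool (Q x)"]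
  by (simp add: of_bool_conj)

lemma dec_less:
  assumes "computable_from A a" "computable_from A b"
  shows "decidable_from A (\<lambda>x. a x < b x)"
proof -
  have *: "of_bool (m < n) = 1 - (1 - (n - m))" for m n :: nat by auto
  show ?thesis unfolding * by (intro cf_diff cf_const assms)
qed

lemma dec_le:
  assumes "computable_from A a" "computable_from A b"
  shows "decidable_from A (\<lambda>x. a x \<le> b x)"
  using dec_not[OF dec_less[OF assms(2,1)]] by (simp add: not_less)

lemma dec_eq:
  assumes "computable_from A a" "computable_from A b"
  shows "decidable_from A (\<lambda>x. a x = b x)"
  using dec_and[OF dec_le[OF assms] dec_le[OF assms(2,1)]] by (simp add: eq_iff)

lemma cf_If:
  assumes "decidable_from A P" "computable_from A a" "computable_from A b"
  shows "computable_from A (\<lambda>x. if P x then a x else b x)"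
proof -
  have *: "(if P x then a x else b x) = of_bool (P x) * a x + (1 - of_bool (P x)) * b x" for x by simp
  show ?thesis unfolding * by (intro cf_add cf_mult cf_diff assms cf_const)
qed

lemma cf_count:
  assumes "decidable_from A (\<lambda>z. P (p1 z) (p2 z))" "computable_from A b"
  shows "computable_from A (\<lambda>x. card {i. i < b x \<and> P x i})"
proof -
  have *: "rec_nat 0 (\<lambda>m r. of_bool (Q m) + r) n = card {i. i < n \<and> Q i}" for n and Q :: "nat \<Rightarrow> bool"
  proof (induction n)
    case (Suc n)
    have "{i. i < Suc n \<and> Q i} = (if Q n then insert n {i. i < n \<and> Q i} else {i. i < n \<and> Q i})"
      by (auto simp: less_Suc_eq)
    then show ?case using Suc by simp
  qed simp
  have "computable_from A (\<lambda>x. rec_nat 0 (\<lambda>m r. of_bool (P x m) + r) (b x))"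
    by (rule cf_rec) (intro cf_const assms cf_add dec_comp2[OF assms(1)] cf_fst cf_snd cf_id)+
  then show ?thesis unfolding * .
qed

lemma dec_ball:
  assumes "decidable_from A (\<lambda>z. P (p1 z) (p2 z))" "computable_from A b"
  shows "decidable_from A (\<lambda>x. \<forall>i<b x. P x i)"
proof -
  have *: "(\<forall>i<n. Q i) \<longleftrightarrow> card {i. i < n \<and> \<not> Q i} = 0" for n and Q :: "nat \<Rightarrow> bool"
    by (subst card_0_eq) auto
  show ?thesis unfolding * by (intro dec_eq cf_count cf_const assms dec_not)
qed

lemma dec_bex:
  assumes "decidable_from A (\<lambda>z. P (p1 z) (p2 z))" "computable_from A b"
  shows "decidable_from A (\<lambda>x. \<exists>i<b x. P x i)"
  using dec_not[OF dec_ball[OF dec_not[OF assms(1)] assms(2)]] by simp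

section \<open>Unbounded search and iteration\<close>

lemma run_Mu:
  assumes "run A q = (\<lambda>z. Some (of_bool (\<not> P (p1 z) (p2 z))))"
  shows "run A (Mu q) = (\<lambda>x. if \<exists>n. P x n then Some (LEAST n. P x n) else None)"
  by (auto simp: assms fun_eq_iff)

lemma mu_program:
  assumes "decidable_from A (\<lambda>z. P (p1 z) (p2 z))"
  obtains q where "run A q = (\<lambda>x. if \<exists>n. P x n then Some (LEAST n. P x n) else None)"
proof -
  obtain q where "run A q = (\<lambda>z. Some (of_bool (\<not> P (p1 z) (p2 z))))"
    using dec_not[OF assms] unfolding computable_from_iff by blast
  from run_Mu[OF this] that show ?thesis by blast
qed

lemma cf_empty: "computable_from {} h \<Longrightarrow> computable_from A h"
  by (rule computable_from_trans[of "{}"]) (auto simp: turing_le_def intro: cf_const)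

text \<open>The search for \<open>z\<close> may diverge at some states. The invariant
  \<open>good\<close> keeps the iteration among states where it ends, so the iteration is total
  although a single step need not be.\<close>

lemma cf_iterate:
  assumes C: "decidable_from A (\<lambda>z. C (p1 z) (p2 z))"
    and next_cf: "computable_from A (\<lambda>z. nxt (p1 z) (p2 z))"
    and good0: "good start"
    and ex: "\<And>a. good a \<Longrightarrow> \<exists>z. C a z"
    and step: "\<And>a. good a \<Longrightarrow> good (nxt a (LEAST z. C a z))"
  shows "computable_from A (\<lambda>k. ((\<lambda>a. nxt a (LEAST z. C a z)) ^^ k) start)"
    and "good (((\<lambda>a. nxt a (LEAST z. C a z)) ^^ k) start)"
proof -
  let ?s = "\<lambda>a. nxt a (LEAST z. C a z)"
  show good: "good ((?s ^^ k) start)" for k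
    by (induction k) (auto simp: good0 step)
  obtain q where q: "run A q = (\<lambda>x. if \<exists>n. C x n then Some (LEAST n. C x n) else None)"
    using mu_program[OF C] .
  obtain o' where o': "run A o' = (\<lambda>z. Some (nxt (p1 z) (p2 z)))"
    using next_cf unfolding computable_from_iff by blast
  \<comment> \<open>\<open>Prec\<close> supplies \<open>(x, (m, a))\<close>. Here
    \<open>Comp Snd Snd\<close> extracts the state \<open>a\<close>, and
    \<open>Tuple Fst Snd\<close> keeps \<open>a\<close> beside the witness found by
    \<open>q\<close>.\<close>
  define S where "S = Comp (Comp o' (Tuple (Tuple Fst Snd) q)) (Comp Snd Snd)"
  have S: "run A S (pr x (pr m a)) = Some (?s a)" if "good a" for x m a
    using ex[OF that] by (simp add: S_def o' q)
  have *: "rec_nat (Some start) (\<lambda>m r. Option.bind r (\<lambda>v. run A S (pr x (pr m v)))) k = Some ((?s ^^ k) start)"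
    for x k by (induction k) (auto simp: S good)
  \<comment> \<open>\<open>Prec\<close> expects a parameter beside the number of rounds;
    \<open>Zero\<close> supplies a dummy.\<close>
  have "run A (Comp (Prec (const_program start) S) (Tuple Zero (Tuple Fst Snd))) = (\<lambda>k. Some ((?s ^^ k) start))"
    by (rule ext) (simp add: *)
  then show "computable_from A (\<lambda>k. (?s ^^ k) start)"
    unfolding computable_from_iff by blast
qed

section \<open>Hard-wired inputs and diagonalization\<close>

lemma cf_const_code: "computable_from A (\<lambda>n. program_code (const_program n))"
proof -
  \<comment> \<open>If \<open>r\<close> is the code of a program \<open>c\<close>, then
    \<open>6 + 4 * pr 1 r\<close> is the code of \<open>Comp Succ c\<close>.\<close>
  have "program_code (const_program n) = rec_nat 0 (\<lambda>_ r. 6 + 4 * pr 1 r) n" for n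
    by (induction n) auto
  moreover have "computable_from A (\<lambda>n. rec_nat 0 (\<lambda>_ r. 6 + 4 * pr 1 r) n)"
    by (rule cf_rec) (intro cf_const cf_add cf_mult cf_pair cf_snd cf_id)+
  ultimately show ?thesis by simp
qed

lemma cf_Comp_const_code: "computable_from A (\<lambda>n. program_code (Comp q (const_program n)))"
  by (simp del: const_program.simps) (intro cf_const cf_add cf_mult cf_pair cf_const_code)

text \<open>The search with \<open>x\<close> hard-wired ignores its input, so it halts on its own
  code exactly when a witness exists.\<close>

lemma dec_jump_ex:
  assumes "decidable_from A (\<lambda>z. P (p1 z) (p2 z))"
  shows "decidable_from (jump A) (\<lambda>x. \<exists>n. P x n)"
proof -
  obtain q where q: "run A q = (\<lambda>x. if \<exists>n. P x n then Some (LEAST n. P x n) else None)"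
    using mu_program[OF assms] .
  have "(\<exists>n. P x n) \<longleftrightarrow> program_code (Comp q (const_program x)) \<in> jump A" for x
    by (simp add: jump_def Phi_def q del: program_code.simps)
  moreover have "decidable_from (jump A) (\<lambda>x. program_code (Comp q (const_program x)) \<in> jump A)"
    by (rule dec_comp[OF _ cf_Comp_const_code]) (use turing_le_refl in \<open>simp add: turing_le_def\<close>)
  ultimately show ?thesis by simp
qed

text \<open>A program with oracle \<open>jump {}\<close> that ignores its input and outputs
  \<open>r\<close> of the least witness for \<open>x\<close> has a code computable from
  \<open>x\<close>. The value of \<open>g\<close> at this code differs from that output.\<close>

lemma DNC_avoid:
  assumes "DNC (jump {}) g" "computable_from A g" "decidable_from (jump {}) (\<lambda>z. P (p1 z) (p2 z))"
    and r: "computable_from (jump {}) r"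
  obtains h where "computable_from A h" "\<And>x. \<exists>z. P x z \<Longrightarrow> h x \<noteq> r (LEAST z. P x z)"
proof -
  obtain q where q: "run (jump {}) q = (\<lambda>x. if \<exists>n. P x n then Some (LEAST n. P x n) else None)"
    using mu_program[OF assms(3)] .
  obtain r' where r': "run (jump {}) r' = (\<lambda>x. Some (r x))"
    using r by (auto simp: computable_from_iff)
  let ?e = "\<lambda>x. program_code (Comp (Comp r' q) (const_program x))"
  have "computable_from A (\<lambda>x. g (?e x))"
    by (rule cf_comp[OF assms(2) cf_Comp_const_code])
  moreover have "g (?e x) \<noteq> r (LEAST z. P x z)" if "\<exists>z. P x z" for x
    using assms(1) that unfolding DNC_def Phi_def by (simp add: q r' del: program_code.simps)
  ultimately show ?thesis using that by blast
qed

text \<open>A pair can avoid several values at once: its first component handles the head of the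
  list, its second component the tail. The values are projected accordingly, hence the
  generalization over \<open>r\<close>.\<close>

lemma DNC_avoid_list:
  assumes "DNC (jump {}) g" "computable_from A g"
    and "\<forall>P\<in>set Ps. decidable_from (jump {}) (\<lambda>z. P (p1 z) (p2 z))"
    and "computable_from (jump {}) r"
  shows "\<exists>h. computable_from A h \<and> (\<forall>P\<in>set Ps. \<forall>x. (\<exists>z. P x z) \<longrightarrow> h x \<noteq> r (LEAST z. P x z))"
  using assms(3,4)
proof (induction Ps arbitrary: r)
  case Nil
  then show ?case using cf_const by auto
next
  case (Cons P Ps)
  obtain h1 where h1: "computable_from A h1" "\<And>x. \<exists>z. P x z \<Longrightarrow> h1 x \<noteq> p1 (r (LEAST z. P x z))"
    using DNC_avoid[OF assms(1,2), of P "\<lambda>x. p1 (r x)"] Cons.prems cf_fst by auto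
  obtain h2 where h2: "computable_from A h2"
    "\<forall>P\<in>set Ps. \<forall>x. (\<exists>z. P x z) \<longrightarrow> h2 x \<noteq> p2 (r (LEAST z. P x z))"
    using Cons.IH[of "\<lambda>x. p2 (r x)"] Cons.prems cf_snd by auto
  have "pr (h1 x) (h2 x) \<noteq> r (LEAST z. Q x z)" if "Q \<in> set (P # Ps)" "\<exists>z. Q x z" for Q x
  proof
    assume *: "pr (h1 x) (h2 x) = r (LEAST z. Q x z)"
    have "h1 x = p1 (r (LEAST z. Q x z))" "h2 x = p2 (r (LEAST z. Q x z))"
      unfolding *[symmetric] by simp_all
    then show False using that h1(2)[of x] h2(2) by (cases "Q = P") (simp, auto 0 3)
  qed
  then show ?case using cf_pair[OF h1(1) h2(1)] by blast
qed

section \<open>Nests\<close>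

text \<open>The number \<open>t\<close> codes an infinite sequence \<open>sq t\<close> of which only initial segments are used;
  \<open>els K D t\<close> and \<open>nest F K c D t\<close> read \<open>t\<close> as a tree of depth \<open>D\<close> branching into the first \<open>K\<close>
  entries.\<close>

definition sq :: "nat \<Rightarrow> nat \<Rightarrow> nat" where
  "sq t i = p1 ((p2 ^^ i) t)"

lemma sq_pr_0 [simp]: "sq (pr x t) 0 = x"
  by (simp add: sq_def)

lemma sq_pr_Suc [simp]: "sq (pr x t) (Suc i) = sq t i"
proof -
  have "(p2 ^^ Suc i) (pr x t) = (p2 ^^ i) (p2 (pr x t))"
    by (simp only: funpow_Suc_right o_apply)
  then show ?thesis unfolding sq_def by simp
qed

lemma ex_sq: "\<exists>t. \<forall>i<K. sq t i = s i"
proof (induction K arbitrary: s)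
  case (Suc K)
  obtain t where "\<forall>i<K. sq t i = s (Suc i)" using Suc[of "s \<circ> Suc"] by auto
  then have "\<forall>i<Suc K. sq (pr (s 0) t) i = s i"
    by (auto simp: less_Suc_eq_0_disj)
  then show ?case by blast
qed simp

primrec els :: "nat \<Rightarrow> nat \<Rightarrow> nat \<Rightarrow> nat set" where
  "els K 0 t = {t}"
| "els K (Suc D) t = (\<Union>i<K. els K D (sq t i))"

lemma finite_els: "finite (els K D t)"
  by (induction D arbitrary: t) auto

lemma els_nonempty: "0 < K \<Longrightarrow> els K D t \<noteq> {}"
  by (induction D arbitrary: t) auto

text \<open>The number \<open>m\<close> of summands is separate from the branching \<open>K\<close>,
  so that it can be minimized while \<open>K\<close> stays fixed.\<close>

definition csum :: "(nat \<Rightarrow> nat \<Rightarrow> nat) \<Rightarrow> nat \<Rightarrow> nat \<Rightarrow> nat \<Rightarrow> nat \<Rightarrow> nat \<Rightarrow> bool" where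
  "csum F c K D m t \<longleftrightarrow> (\<forall>j<m. \<forall>i<j. \<forall>x\<in>els K D (sq t i). \<forall>y\<in>els K D (sq t j). x < y \<and> F x y = c)"

primrec nest :: "(nat \<Rightarrow> nat \<Rightarrow> nat) \<Rightarrow> nat \<Rightarrow> nat \<Rightarrow> nat \<Rightarrow> nat \<Rightarrow> bool" where
  "nest F K c 0 t = True"
| "nest F K c (Suc D) t \<longleftrightarrow> (\<forall>i<K. nest F K (1 - c) D (sq t i)) \<and> csum F c K D K t"

text \<open>The leaves satisfying \<open>B\<close> contain a full \<open>N\<close>-branching
  subtree. If this fails at an inner node, a path has fewer than \<open>N\<close> children to avoid
  there.\<close>

primrec heavy :: "(nat \<Rightarrow> bool) \<Rightarrow> nat \<Rightarrow> nat \<Rightarrow> nat \<Rightarrow> nat \<Rightarrow> bool" where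
  "heavy B N K 0 t = B t"
| "heavy B N K (Suc D) t \<longleftrightarrow> N \<le> card {i. i < K \<and> heavy B N K D (sq t i)}"

lemma heavy_mono: "heavy B N K D t \<Longrightarrow> (\<And>x. B x \<Longrightarrow> B' x) \<Longrightarrow> heavy B' N K D t"
proof (induction D arbitrary: t)
  case (Suc D)
  have "{i. i < K \<and> heavy B N K D (sq t i)} \<subseteq> {i. i < K \<and> heavy B' N K D (sq t i)}"
    using Suc by blast
  from card_mono[OF _ this] Suc.prems(1) show ?case by simp
qed simp

text \<open>Keeping \<open>N\<close> heavy children at every node, in their original order,
  preserves the order and the colors between summands.\<close>

lemma heavy_nest:
  assumes "nest F K c D t" "heavy B N K D t"
  shows "\<exists>u. nest F N c D u \<and> els N D u \<subseteq> els K D t \<inter> {x. B x}"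
  using assms
proof (induction D arbitrary: c t)
  case 0
  then show ?case by (intro exI[of _ t]) simp
next
  case (Suc D)
  define I where "I = {i. i < K \<and> heavy B N K D (sq t i)}"
  have fin: "finite I" by (simp add: I_def)
  \<comment> \<open>The heavy children in increasing order; only the first \<open>N\<close> entries
    are used.\<close>
  define \<phi> where "\<phi> i = sorted_list_of_set I ! i" for i
  have len: "N \<le> length (sorted_list_of_set I)"
    using Suc.prems(2) by (simp add: I_def)
  have \<phi>I: "\<phi> i \<in> I" if "i < N" for i
    using that len fin nth_mem[of i "sorted_list_of_set I"] by (simp add: \<phi>_def)
  have \<phi>_less: "\<phi> i < \<phi> j" if "i < j" "j < N" for i j
    unfolding \<phi>_def using that len
    by (intro sorted_wrt_nth_less[OF sorted_list_of_set.strict_sorted_key_list_of_set]) auto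
  have "\<exists>u. nest F N (1 - c) D u \<and> els N D u \<subseteq> els K D (sq t (\<phi> i)) \<inter> {x. B x}" if "i < N" for i
    using Suc.IH[of "1 - c" "sq t (\<phi> i)"] Suc.prems(1) \<phi>I[OF that] by (auto simp: I_def)
  then have "\<forall>i\<in>{..<N}. \<exists>u. nest F N (1 - c) D u \<and> els N D u \<subseteq> els K D (sq t (\<phi> i)) \<inter> {x. B x}"
    by blast
  from bchoice[OF this] obtain s where s: "\<And>i. i < N \<Longrightarrow> nest F N (1 - c) D (s i) \<and>
      els N D (s i) \<subseteq> els K D (sq t (\<phi> i)) \<inter> {x. B x}" by blast
  obtain u where u: "\<forall>i<N. sq u i = s i" using ex_sq by blast
  have "csum F c N D N u"
    unfolding csum_def
  proof (intro allI impI ballI)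
    fix i j x y assume *: "j < N" "i < j" "x \<in> els N D (sq u i)" "y \<in> els N D (sq u j)"
    then have "x \<in> els K D (sq t (\<phi> i))" "y \<in> els K D (sq t (\<phi> j))" using s[of i] s[of j] u by auto
    moreover have "\<phi> j < K" "\<phi> i < \<phi> j" using \<phi>I[of j] \<phi>_less * by (auto simp: I_def)
    ultimately show "x < y \<and> F x y = c" using Suc.prems(1) unfolding nest.simps csum_def by blast
  qed
  moreover have "els N (Suc D) u \<subseteq> els K (Suc D) t \<inter> {x. B x}"
  proof
    fix x assume "x \<in> els N (Suc D) u"
    then obtain i where i: "i < N" "x \<in> els N D (s i)" using u by auto
    then have "x \<in> els K D (sq t (\<phi> i))" "B x" "\<phi> i < K" using s \<phi>I by (auto simp: I_def)
    then show "x \<in> els K (Suc D) t \<inter> {x. B x}" by auto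
  qed
  moreover have "\<forall>i<N. nest F N (1 - c) D (sq u i)" using s u by simp
  ultimately show ?case unfolding nest.simps by blast
qed

section \<open>Patterns inside nests\<close>

definition contains :: "(nat \<Rightarrow> nat \<Rightarrow> nat) \<Rightarrow> nat \<Rightarrow> (nat \<Rightarrow> nat) \<Rightarrow> nat set \<Rightarrow> bool" where
  "contains F l \<pi> S \<longleftrightarrow> (\<exists>\<phi>. (\<forall>j<l. \<phi> j \<in> S \<and> (\<forall>i<j. \<phi> i < \<phi> j \<and> F (\<phi> i) (\<phi> j) = perm_pattern \<pi> (i, j))))"

lemma contains_mono: "contains F l \<pi> S \<Longrightarrow> S \<subseteq> S' \<Longrightarrow> contains F l \<pi> S'"
  unfolding contains_def by blast

lemma contains_sum:
  assumes "contains F m \<pi> S" "contains F n \<sigma> T"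
    and cross: "\<And>x y. x \<in> S \<Longrightarrow> y \<in> T \<Longrightarrow> x < y \<and> F x y = c"
    and \<rho>1: "\<And>i j. i < j \<Longrightarrow> j < m \<Longrightarrow> perm_pattern \<rho> (i, j) = perm_pattern \<pi> (i, j)"
    and \<rho>2: "\<And>i j. i < j \<Longrightarrow> j < n \<Longrightarrow> perm_pattern \<rho> (m + i, m + j) = perm_pattern \<sigma> (i, j)"
    and \<rho>3: "\<And>i j. i < m \<Longrightarrow> j < n \<Longrightarrow> perm_pattern \<rho> (i, m + j) = c"
  shows "contains F (m + n) \<rho> (S \<union> T)"
proof -
  obtain \<phi> \<psi> where \<phi>: "\<forall>j<m. \<phi> j \<in> S \<and> (\<forall>i<j. \<phi> i < \<phi> j \<and> F (\<phi> i) (\<phi> j) = perm_pattern \<pi> (i, j))"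
    and \<psi>: "\<forall>j<n. \<psi> j \<in> T \<and> (\<forall>i<j. \<psi> i < \<psi> j \<and> F (\<psi> i) (\<psi> j) = perm_pattern \<sigma> (i, j))"
    using assms(1,2) unfolding contains_def by blast
  define \<chi> where "\<chi> i = (if i < m then \<phi> i else \<psi> (i - m))" for i
  have "\<chi> i < \<chi> j \<and> F (\<chi> i) (\<chi> j) = perm_pattern \<rho> (i, j)" if "j < m + n" "i < j" for i j
  proof (cases "j < m")
    case True
    then show ?thesis using that \<phi> \<rho>1 by (simp add: \<chi>_def)
  next
    case False
    then have j: "j = m + (j - m)" "j - m < n" using that by auto
    show ?thesis
    proof (cases "i < m")
      case True
      then show ?thesis using j False \<phi> \<psi> cross \<rho>3[of i "j - m"] by (simp add: \<chi>_def)
    next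
      case False': False
      then have "i = m + (i - m)" "i - m < j - m" using that by auto
      then show ?thesis using j False False' \<psi> \<rho>2[of "i - m" "j - m"] by (simp add: \<chi>_def)
    qed
  qed
  moreover have "\<chi> j \<in> S \<union> T" if "j < m + n" for j
    using that \<phi> \<psi> by (auto simp: \<chi>_def)
  ultimately show ?thesis unfolding contains_def by blast
qed

text \<open>The first two summands supply the occurrences of \<open>\<pi>\<close> and
  \<open>\<sigma>\<close>; the outer color \<open>c\<close> settles all pairs between them.\<close>

lemma contains_nest_sum:
  assumes "\<And>t. nest F 2 (1 - c) D t \<Longrightarrow> contains F m \<pi> (els 2 D t)"
    and "\<And>t. nest F 2 (1 - c) D t \<Longrightarrow> contains F n \<sigma> (els 2 D t)"
    and nest: "nest F 2 c (Suc D) t"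
    and "\<And>i j. i < j \<Longrightarrow> j < m \<Longrightarrow> perm_pattern \<rho> (i, j) = perm_pattern \<pi> (i, j)"
    and "\<And>i j. i < j \<Longrightarrow> j < n \<Longrightarrow> perm_pattern \<rho> (m + i, m + j) = perm_pattern \<sigma> (i, j)"
    and "\<And>i j. i < m \<Longrightarrow> j < n \<Longrightarrow> perm_pattern \<rho> (i, m + j) = c"
  shows "contains F (m + n) \<rho> (els 2 (Suc D) t)"
proof -
  have "contains F (m + n) \<rho> (els 2 D (sq t 0) \<union> els 2 D (sq t 1))"
  proof (rule contains_sum[OF _ _ _ assms(4-6)])
    show "x < y \<and> F x y = c" if "x \<in> els 2 D (sq t 0)" "y \<in> els 2 D (sq t 1)" for x y
      using nest that unfolding nest.simps csum_def by (metis less_numeral_extra(1) one_less_numeral_iff semiring_norm(76))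
    show "contains F m \<pi> (els 2 D (sq t 0))" using nest by (intro assms(1)) simp
    show "contains F n \<sigma> (els 2 D (sq t 1))" using nest by (intro assms(2)) simp
  qed
  moreover have "els 2 D (sq t 0) \<union> els 2 D (sq t 1) \<subseteq> els 2 (Suc D) t"
    by (simp add: numeral_2_eq_2 lessThan_Suc)
  ultimately show ?thesis by (rule contains_mono)
qed

text \<open>Asking for all large depths lets both parts of a sum be sought at a common depth; asking
  for both colors covers summands, whose outer color is flipped.\<close>

definition unavoidable :: "(nat \<Rightarrow> nat \<Rightarrow> nat) \<Rightarrow> nat \<Rightarrow> (nat \<Rightarrow> nat) \<Rightarrow> bool" where
  "unavoidable F l \<pi> \<longleftrightarrow> (\<exists>d0. \<forall>d\<ge>d0. \<forall>c\<le>1. \<forall>t. nest F 2 c d t \<longrightarrow> contains F l \<pi> (els 2 d t))"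

lemma unavoidable_sum:
  assumes "unavoidable F m \<pi>" "unavoidable F n \<sigma>" "e \<le> 1"
    and \<rho>: "\<And>i j. i < j \<Longrightarrow> j < m \<Longrightarrow> perm_pattern \<rho> (i, j) = perm_pattern \<pi> (i, j)"
      "\<And>i j. i < j \<Longrightarrow> j < n \<Longrightarrow> perm_pattern \<rho> (m + i, m + j) = perm_pattern \<sigma> (i, j)"
      "\<And>i j. i < m \<Longrightarrow> j < n \<Longrightarrow> perm_pattern \<rho> (i, m + j) = e"
  shows "unavoidable F (m + n) \<rho>"
proof -
  obtain d1 d2 where d1: "\<And>d c t. d1 \<le> d \<Longrightarrow> c \<le> 1 \<Longrightarrow> nest F 2 c d t \<Longrightarrow> contains F m \<pi> (els 2 d t)"
    and d2: "\<And>d c t. d2 \<le> d \<Longrightarrow> c \<le> 1 \<Longrightarrow> nest F 2 c d t \<Longrightarrow> contains F n \<sigma> (els 2 d t)"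
    using assms(1,2) unfolding unavoidable_def by blast
  have "contains F (m + n) \<rho> (els 2 d t)"
    \<comment> \<open>One extra level hosts the sum; the other is spent on descending when the outer
      color is not \<open>e\<close>.\<close>
    if "Suc (Suc (max d1 d2)) \<le> d" "c \<le> 1" "nest F 2 c d t" for d c t
  proof -
    obtain D where D: "d = Suc (Suc D)" "max d1 d2 \<le> D"
      using \<open>_ \<le> d\<close> by (metis Suc_le_D Suc_le_mono)
    have sum: "contains F (m + n) \<rho> (els 2 (Suc D') u)" if nu: "nest F 2 e (Suc D') u" and "max d1 d2 \<le> D'" for D' u
    proof (rule contains_nest_sum[OF _ _ nu \<rho>])
      show "contains F m \<pi> (els 2 D' t)" if "nest F 2 (1 - e) D' t" for t
        by (rule d1[OF _ _ that]) (use \<open>max d1 d2 \<le> D'\<close> in simp_all)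
      show "contains F n \<sigma> (els 2 D' t)" if "nest F 2 (1 - e) D' t" for t
        by (rule d2[OF _ _ that]) (use \<open>max d1 d2 \<le> D'\<close> in simp_all)
    qed
    show ?thesis
    proof (cases "c = e")
      case True
      then show ?thesis using sum[of "Suc D" t] that D by simp
    next
      case False
      then have "e = 1 - c" using that(2) assms(3) by auto
      then have "nest F 2 e (Suc D) (sq t 0)" using that(3) unfolding D by simp
      then have "contains F (m + n) \<rho> (els 2 (Suc D) (sq t 0))" using sum D by simp
      then show ?thesis 
        by (rule contains_mono) (unfold D els.simps(2)[of 2 "Suc D"], blast intro: zero_less_numeral)
    qed
  qed
  then show ?thesis unfolding unavoidable_def by blast
qed

text \<open>Pairs across a direct sum have value 0, because the images of the first part stay below
  \<open>m\<close>. Across a skew sum they have value 1, because the images of the second part stay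
  below \<open>n\<close>.\<close>

lemma separable_unavoidable: "separable l \<pi> \<Longrightarrow> unavoidable F l \<pi>"
proof (induction rule: separable.induct)
  case one
  have "contains F 1 id (els 2 d t)" for d t
  proof -
    obtain x where "x \<in> els 2 d t" using els_nonempty[of 2 d t] by auto
    then show ?thesis unfolding contains_def by (intro exI[of _ "\<lambda>_. x"]) auto
  qed
  then show ?case unfolding unavoidable_def by blast
next
  case (direct m \<pi> n \<sigma>)
  show ?case
  proof (rule unavoidable_sum[where e = 0, OF direct.IH])
    show "perm_pattern (direct_sum m \<pi> n \<sigma>) (i, m + j) = 0" if "i < m" "j < n" for i j
      using that permutes_lessThan_less[OF separable_permutes[OF direct.hyps(1)], of i]
      by (simp add: perm_pattern_def direct_sum_def)
  qed (auto simp: perm_pattern_def direct_sum_def)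
next
  case (skew m \<pi> n \<sigma>)
  show ?case
  proof (rule unavoidable_sum[where e = 1, OF skew.IH])
    show "perm_pattern (skew_sum m \<pi> n \<sigma>) (i, m + j) = 1" if "i < m" "j < n" for i j
      using that permutes_lessThan_less[OF separable_permutes[OF skew.hyps(2)], of j]
      by (simp add: perm_pattern_def skew_sum_def)
  qed (auto simp: perm_pattern_def skew_sum_def)
qed

lemma avoids_not_contains:
  assumes "avoids f l p" "p = perm_pattern \<pi>" "\<And>x y. x < y \<Longrightarrow> F x y = f (x, y)"
  shows "\<not> contains F l \<pi> S"
proof
  assume "contains F l \<pi> S"
  then obtain \<phi> where \<phi>: "\<And>i j. i < j \<Longrightarrow> j < l \<Longrightarrow> \<phi> i < \<phi> j \<and> F (\<phi> i) (\<phi> j) = p (i, j)"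
    unfolding contains_def assms(2) by blast
  let ?xs = "map \<phi> [0..<l]"
  have "sorted_wrt (<) ?xs" using \<phi> by (auto simp: sorted_wrt_iff_nth_less)
  then have xs: "sorted_list_of_set (\<phi> ` {..<l}) = ?xs"
    using sorted_list_of_set.idem_if_sorted_distinct[of ?xs] 
    by (simp add: strict_sorted_iff atLeast_upt)
  then have "card (\<phi> ` {..<l}) = l"
    by (metis length_map length_upt minus_nat.diff_0 sorted_list_of_set.length_sorted_key_list_of_set)
  moreover have "f (\<phi> i, \<phi> j) = p (i, j)" if "i < j" "j < l" for i j
    using \<phi>[OF that] assms(3)[of "\<phi> i" "\<phi> j"] by simp
  ultimately have "realizes f l p (\<phi> ` {..<l})"
    unfolding realizes_def xs by (auto simp: pairs_def)
  then show False using assms(1) unfolding avoids_def by blast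
qed

section \<open>The dichotomy for nests in computable infinite sets\<close>

definition cset :: "nat set \<Rightarrow> bool" where
  "cset Y \<longleftrightarrow> infinite Y \<and> decidable_from {} (\<lambda>x. x \<in> Y)"

lemma cset_Int:
  assumes "cset X" "decidable_from {} P" "infinite {x \<in> X. P x}"
  shows "cset {x \<in> X. P x}"
  using assms dec_and[of "{}" "\<lambda>x. x \<in> X" P] by (simp add: cset_def)

text \<open>Minimality of the depth makes arbitrarily wide nests of the next smaller depth available
  everywhere. Minimality of the number of summands forbids a nest all of whose elements are joined to
  almost all of \<open>Y\<close> in the outer color \<open>1 - e\<close>: it could be put in front of the remaining summands.\<close>

lemma nest_dichotomy:
  assumes comp: "computable_from {} (\<lambda>z. F (p1 z) (p2 z))"
    and F01: "\<And>x y. F x y \<le> 1"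
    and none: "\<not> (\<exists>t. nest F K0 0 d0 t)"
  obtains X D N e where "cset X"
    "\<And>Y K. Y \<subseteq> X \<Longrightarrow> cset Y \<Longrightarrow> \<exists>t. nest F K e D t \<and> els K D t \<subseteq> Y"
    "\<And>Y t. Y \<subseteq> X \<Longrightarrow> cset Y \<Longrightarrow> nest F N e D t \<Longrightarrow> els N D t \<subseteq> X \<Longrightarrow>
      \<exists>x\<in>els N D t. infinite {y \<in> Y. F x y = e}"
proof -
  \<comment> \<open>Depth \<open>d\<close> fails if some computable infinite set omits the nests of
    some width and color.\<close>
  define P where "P d \<longleftrightarrow> (\<exists>X N c. cset X \<and> c \<le> 1 \<and> \<not> (\<exists>t. nest F N c d t \<and> els N d t \<subseteq> X))" for d
  have "cset UNIV" by (simp add: cset_def cf_const)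
  then have "P d0" using none unfolding P_def by blast
  have "\<not> P 0"
  proof
    assume "P 0"
    then obtain X N c where X: "cset X" "\<not> (\<exists>t. nest F N c 0 t \<and> els N 0 t \<subseteq> X)"
      unfolding P_def by blast
    then obtain x where "x \<in> X" unfolding cset_def using infinite_imp_nonempty by blast
    then show False using X(2) by simp
  qed
  \<comment> \<open>\<open>Suc D\<close> is the least failing depth; depth 0 never fails, its nests
    being single elements.\<close>
  obtain D where "P (Suc D)" and nP: "\<not> P D"
    using ex_least_nat_less[of P d0, OF \<open>P d0\<close> \<open>\<not> P 0\<close>] by auto
  obtain X0 N c where X0: "cset X0" "c \<le> 1" "\<not> (\<exists>t. nest F N c (Suc D) t \<and> els N (Suc D) t \<subseteq> X0)"
    using \<open>P (Suc D)\<close> unfolding P_def by blast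
  \<comment> \<open>A partial nest inside \<open>X\<close>: \<open>m\<close> summands at the top,
    each still of inner width \<open>N\<close>.\<close>
  define sm where "sm X m t \<longleftrightarrow> (\<forall>i<m. nest F N (1 - c) D (sq t i)) \<and> csum F c N D m t \<and>
    (\<forall>i<m. els N D (sq t i) \<subseteq> X)" for X m t
  define Q where "Q m \<longleftrightarrow> (\<exists>X\<subseteq>X0. cset X \<and> \<not> (\<exists>t. sm X m t))" for m
  have "Q N" unfolding Q_def
  proof (intro exI[of _ X0] conjI notI)
    assume "\<exists>t. sm X0 N t"
    then obtain t where "sm X0 N t" ..
    then have "nest F N c (Suc D) t" "els N (Suc D) t \<subseteq> X0"
      unfolding sm_def by auto
    then show False using X0(3) by blast
  qed (use X0 in auto)
  have "\<not> Q 0" unfolding Q_def sm_def csum_def by simp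
  \<comment> \<open>Every computable infinite part of \<open>X0\<close> has \<open>m\<close>
    summands, but some such part lacks \<open>Suc m\<close>.\<close>
  obtain m where "Q (Suc m)" and nQ: "\<not> Q m"
    using ex_least_nat_less[of Q N, OF \<open>Q N\<close> \<open>\<not> Q 0\<close>] by auto
  obtain X where X: "X \<subseteq> X0" "cset X" "\<not> (\<exists>t. sm X (Suc m) t)"
    using \<open>Q (Suc m)\<close> unfolding Q_def by blast
  \<comment> \<open>The color \<open>e\<close> of the conclusion is \<open>1 - c\<close>, the outer
    color of the summands.\<close>
  have av: "\<exists>t. nest F K (1 - c) D t \<and> els K D t \<subseteq> Y" if "Y \<subseteq> X" "cset Y" for Y K
    using nP \<open>cset Y\<close> diff_le_self[of 1 c] unfolding P_def by blast
  have bad: "\<exists>x\<in>els N D t. infinite {y \<in> Y. F x y = 1 - c}"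
      if Y: "Y \<subseteq> X" "cset Y" and t: "nest F N (1 - c) D t" "els N D t \<subseteq> X" for Y t
    proof (rule ccontr)
      assume "\<not> ?thesis"
      then have "finite (els N D t \<union> (\<Union>x\<in>els N D t. {y \<in> Y. F x y = 1 - c}))"
        using finite_els by blast
      \<comment> \<open>Beyond \<open>b\<close>, every element of \<open>Y\<close> is joined to the
        whole nest in color \<open>c\<close>.\<close>
      then obtain b where b: "\<And>x. x \<in> els N D t \<union> (\<Union>x\<in>els N D t. {y \<in> Y. F x y = 1 - c}) \<Longrightarrow> x < b"
        by (meson finite_nat_set_iff_bounded)
      have "cset {y \<in> Y. b \<le> y}"
      proof (rule cset_Int[OF Y(2)])
        show "decidable_from {} (\<lambda>x. b \<le> x)" by (intro dec_le cf_basic)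
        show "infinite {y \<in> Y. b \<le> y}"
        proof
          assume "finite {y \<in> Y. b \<le> y}"
          moreover have "Y \<subseteq> {y \<in> Y. b \<le> y} \<union> {..<b}" by auto
          ultimately have "finite Y" by (meson finite_Un finite_lessThan finite_subset)
          then show False using Y(2) by (simp add: cset_def)
        qed
      qed
      moreover have "{y \<in> Y. b \<le> y} \<subseteq> X0" using X(1) Y(1) by auto
      ultimately have "\<exists>u. sm {y \<in> Y. b \<le> y} m u"
        using nQ unfolding Q_def by simp
      then obtain u where u: "sm {y \<in> Y. b \<le> y} m u" ..
      have cross: "x < y \<and> F x y = c" if "x \<in> els N D t" "y \<in> {y \<in> Y. b \<le> y}" for x y
      proof -
        have "y \<notin> {y \<in> Y. F x y = 1 - c}" using b[of y] that by auto
        then have "F x y \<noteq> 1 - c" using that by simp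
        then have "F x y = c" using F01[of x y] X0(2) by linarith
        moreover have "x < b" using b that by blast
        ultimately show ?thesis using that by simp
      qed
      \<comment> \<open>Prepending \<open>t\<close> to the \<open>m\<close> summands found beyond
        \<open>b\<close> yields the \<open>Suc m\<close> summands that \<open>X\<close>
        lacks.\<close>
      have "sm X (Suc m) (pr t u)"
        unfolding sm_def csum_def
      proof (intro conjI allI impI ballI)
        show "nest F N (1 - c) D (sq (pr t u) i)" if "i < Suc m" for i
          using that t(1) u by (cases i) (auto simp: sm_def)
        show "els N D (sq (pr t u) i) \<subseteq> X" if "i < Suc m" for i
        proof (cases i)
          case (Suc i')
          then have "i' < m" using that by simp
          then have "els N D (sq u i') \<subseteq> {y \<in> Y. b \<le> y}" using u unfolding sm_def by blast
          also have "\<dots> \<subseteq> X" using Y(1) by blast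
          finally show ?thesis unfolding Suc sq_pr_Suc .
        next
          case 0
          then show ?thesis using t(2) by simp
        qed
        fix i j x y assume *: "j < Suc m" "i < j" "x \<in> els N D (sq (pr t u) i)" "y \<in> els N D (sq (pr t u) j)"
        then obtain j' where j': "j = Suc j'" "j' < m" by (cases j) auto
        then have y: "y \<in> els N D (sq u j')" using * by simp
        have "x < y \<and> F x y = c"
        proof (cases i)
          case 0
          then have "x \<in> els N D t" using *(3) by simp
          moreover have "y \<in> {y \<in> Y. b \<le> y}" using u y j'(2) unfolding sm_def by blast
          ultimately show ?thesis by (rule cross)
        next
          case (Suc i')
          then have "x \<in> els N D (sq u i')" "i' < j'" using *(2,3) j'(1) by simp_all
          then show ?thesis using u y j'(2) unfolding sm_def csum_def by blast
        qed
        then show "x < y" "F x y = c" by blast+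
      qed
      then show False using X(3) by blast
    qed
  show ?thesis
    by (rule that[OF X(2) av bad])
qed

section \<open>Decidability of nest predicates\<close>

lemma cf_sq:
  assumes "computable_from A a" "computable_from A b"
  shows "computable_from A (\<lambda>x. sq (a x) (b x))"
proof -
  have *: "rec_nat t (\<lambda>_ r. p2 r) i = (p2 ^^ i) t" for t i by (induction i) auto
  have "computable_from A (\<lambda>x. p1 (rec_nat (a x) (\<lambda>_ r. p2 r) (b x)))"
    by (rule cf_fst, rule cf_rec) (intro cf_basic assms)+
  then show ?thesis unfolding * sq_def .
qed

text \<open>Induction on the fixed depth. The index of a child joins the parameter, so
  \<open>P\<close>, \<open>k\<close> and \<open>t\<close> must be general.\<close>

lemma dec_els_ball:
  assumes "decidable_from A (\<lambda>z. P (p1 z) (p2 z))" "computable_from A k" "computable_from A t"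
  shows "decidable_from A (\<lambda>x. \<forall>y\<in>els (k x) D (t x). P x y)"
  using assms
proof (induction D arbitrary: P k t)
  case 0
  then show ?case using dec_comp2[OF 0(1) cf_id 0(3)] by simp
next
  case (Suc D)
  have "decidable_from A (\<lambda>x. \<forall>i<k x. \<forall>y\<in>els (k x) D (sq (t x) i). P x y)"
  proof (intro dec_ball Suc.prems(2) Suc.IH)
    show "decidable_from A (\<lambda>z. P (p1 (p1 z)) (p2 z))"
      by (intro dec_comp2[OF Suc.prems(1)] cf_basic)
  qed (intro cf_sq cf_basic cf_comp[OF Suc.prems(2)] cf_comp[OF Suc.prems(3)])+
  moreover have "(\<forall>y\<in>els (k x) (Suc D) (t x). P x y) \<longleftrightarrow> (\<forall>i<k x. \<forall>y\<in>els (k x) D (sq (t x) i). P x y)" for x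
    by auto
  ultimately show ?case by simp
qed

lemma dec_csum:
  assumes F: "computable_from A (\<lambda>z. F (p1 z) (p2 z))"
    and "computable_from A k" "computable_from A m" "computable_from A t"
  shows "decidable_from A (\<lambda>x. csum F c (k x) D (m x) (t x))"
  unfolding csum_def
  by (intro dec_ball dec_els_ball dec_and dec_less dec_eq cf_comp2[OF F] cf_sq cf_basic
      assms(2-4) cf_comp[OF assms(2)] cf_comp[OF assms(4)])

lemma dec_nest:
  assumes F: "computable_from A (\<lambda>z. F (p1 z) (p2 z))"
    and "computable_from A k" "computable_from A t"
  shows "decidable_from A (\<lambda>x. nest F (k x) c D (t x))"
  using assms(2,3)
proof (induction D arbitrary: c k t)
  case 0
  then show ?case by (simp add: cf_const)
next
  case (Suc D)
  show ?case unfolding nest.simps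
    by (intro dec_and dec_ball Suc.IH dec_csum[OF F] Suc.prems cf_sq cf_basic
        cf_comp[OF Suc.prems(1)] cf_comp[OF Suc.prems(2)])
qed

lemma dec_heavy:
  assumes "decidable_from A (\<lambda>z. B (p1 z) (p2 z))" "computable_from A k" "computable_from A t"
  shows "decidable_from A (\<lambda>x. heavy (B x) N (k x) D (t x))"
  using assms
proof (induction D arbitrary: B k t)
  case 0
  then show ?case using dec_comp2[OF 0(1) cf_id 0(3)] by simp
next
  case (Suc D)
  have "decidable_from A (\<lambda>z. heavy (B (p1 z)) N (k (p1 z)) D (sq (t (p1 z)) (p2 z)))"
    by (rule Suc.IH[of "\<lambda>z. B (p1 z)"])
      (intro dec_comp2[OF Suc.prems(1)] cf_sq cf_basic cf_comp[OF Suc.prems(2)] cf_comp[OF Suc.prems(3)])+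
  then show ?case unfolding heavy.simps by (intro dec_le cf_basic cf_count Suc.prems)
qed

text \<open>A path is coded by nested pairs of child indices, independently of any tree, so it can
  be chosen before the tree is known. It stays in a tree of width \<open>K\<close> once its largest
  index, given by \<open>mx\<close>, is below \<open>K\<close>.\<close>

primrec elem :: "nat \<Rightarrow> nat \<Rightarrow> nat \<Rightarrow> nat" where
  "elem 0 t v = t"
| "elem (Suc D) t v = elem D (sq t (p1 v)) (p2 v)"

primrec mx :: "nat \<Rightarrow> nat \<Rightarrow> nat" where
  "mx 0 v = 0"
| "mx (Suc D) v = max (p1 v) (mx D (p2 v))"

lemma elem_in_els: "mx D v < K \<Longrightarrow> elem D t v \<in> els K D t"
  by (induction D arbitrary: t v) auto

lemma cf_elem:
  assumes "computable_from A t" "computable_from A v"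
  shows "computable_from A (\<lambda>x. elem D (t x) (v x))"
  using assms by (induction D arbitrary: t v) (auto intro!: cf_sq cf_fst cf_snd)

lemma cf_mx:
  assumes "computable_from A v"
  shows "computable_from A (\<lambda>x. mx D (v x))"
  using assms
proof (induction D arbitrary: v)
  case (Suc D)
  show ?case unfolding mx.simps max_def
    by (intro cf_If dec_le cf_basic Suc)
qed (simp add: cf_const)

section \<open>Paths chosen in advance\<close>

lemma rank_inj:
  assumes "i \<in> W" "j \<in> W" "card {k \<in> W. k < i} = card {k \<in> W. k < j}"
  shows "i = (j :: nat)"
proof (rule ccontr)
  have *: "card {k \<in> W. k < a} < card {k \<in> W. k < b}" if "a \<in> W" "a < b" for a b
  proof (rule psubset_card_mono)
    show "{k \<in> W. k < a} \<subset> {k \<in> W. k < b}" using that by auto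
  qed simp
  assume "i \<noteq> j"
  then show False using *[OF assms(1), of j] *[OF assms(2), of i] assms(3) by linarith
qed

text \<open>A set with fewer than \<open>N\<close> elements that is enumerated in stages is avoided by guessing its size
  \<open>r\<close> and diagonalising against the element of rank \<open>s\<close> at the first stage with \<open>r\<close> elements.\<close>

lemma avoid_small:
  assumes g: "DNC (jump {}) g" "computable_from A g"
    and G: "decidable_from (jump {}) (\<lambda>u. G (p1 u) (p2 u))"
    and k: "computable_from (jump {}) (\<lambda>u. k (p1 u) (p2 u))"
    and C: "decidable_from (jump {}) (\<lambda>u. C (p1 u) (p1 (p2 u)) (p1 (p2 (p2 u))) (p2 (p2 (p2 u))))"
    and mono: "\<And>w z m m' i. C w z m i \<Longrightarrow> m \<le> m' \<Longrightarrow> C w z m' i"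
  shows "\<exists>h. computable_from A h \<and> (\<forall>w z m. G w z \<longrightarrow> (\<forall>z'. G w z' \<longrightarrow> z' = z) \<longrightarrow>
    (\<forall>m. card {i. i < k w z \<and> C w z m i} < N) \<longrightarrow> h w < k w z \<longrightarrow> \<not> C w z m (h w))"
proof -
  \<comment> \<open>Here \<open>y\<close> codes a candidate element, the object \<open>z\<close> and
    a stage. At this stage the set has at least \<open>r\<close> elements, and the candidate is its
    element of rank \<open>s\<close>.\<close>
  define P where "P r s w y \<longleftrightarrow> G w (p1 (p2 y)) \<and> p1 y < k w (p1 (p2 y)) \<and> C w (p1 (p2 y)) (p2 (p2 y)) (p1 y) \<and>
     r \<le> card {i. i < k w (p1 (p2 y)) \<and> C w (p1 (p2 y)) (p2 (p2 y)) i} \<and>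
     card {i. i < p1 y \<and> (i < k w (p1 (p2 y)) \<and> C w (p1 (p2 y)) (p2 (p2 y)) i)} = s" for r s w y
  have C': "decidable_from (jump {}) (\<lambda>x. C (a x) (b x) (c x) (d x))"
    if "computable_from (jump {}) a" "computable_from (jump {}) b" "computable_from (jump {}) c"
      "computable_from (jump {}) d" for a b c d
    using dec_comp[OF C cf_pair[OF that(1) cf_pair[OF that(2) cf_pair[OF that(3,4)]]]] by simp
  have dP: "decidable_from (jump {}) (\<lambda>u. P r s (p1 u) (p2 u))" for r s
    unfolding P_def
    by (intro dec_and dec_less dec_le dec_eq cf_count dec_comp2[OF G] cf_comp2[OF k] C' cf_basic)
  \<comment> \<open>All guesses of size and rank below \<open>N\<close>; being finitely many, they
    are avoided by a single \<open>h\<close>.\<close>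
  define Ps where "Ps = concat (map (\<lambda>r. map (P r) [0..<N]) [0..<N])"
  have "\<forall>P\<in>set Ps. decidable_from (jump {}) (\<lambda>z. P (p1 z) (p2 z))"
    using dP by (auto simp: Ps_def)
  from DNC_avoid_list[OF g this cf_fst[OF cf_id]] obtain h where h: "computable_from A h"
    and hP: "\<And>r s x. r < N \<Longrightarrow> s < N \<Longrightarrow> \<exists>z. P r s x z \<Longrightarrow> h x \<noteq> p1 (LEAST z. P r s x z)"
    by (auto simp: Ps_def)
  have "\<not> C w z m0 (h w)" if Gz: "G w z" "\<forall>z'. G w z' \<longrightarrow> z' = z"
    and small: "\<forall>m. card {i. i < k w z \<and> C w z m i} < N" and hk: "h w < k w z" for w z m0
  proof
    assume bad: "C w z m0 (h w)"
    define W where "W m = {i. i < k w z \<and> C w z m i}" for m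
    have fin: "finite (W m)" for m by (simp add: W_def)
    have W_mono: "W m \<subseteq> W m'" if "m \<le> m'" for m m'
      using mono that unfolding W_def by blast
    \<comment> \<open>The final size of the set.\<close>
    define r where "r = Max (range (\<lambda>m. card (W m)))"
    have frange: "finite (range (\<lambda>m. card (W m)))"
      by (rule finite_subset[of _ "{..<N}"]) (use small in \<open>auto simp: W_def\<close>)
    then have "r \<in> range (\<lambda>m. card (W m))" unfolding r_def by (intro Max_in) auto
    then obtain m' where m': "card (W m') = r" by auto
    have le_r: "card (W m) \<le> r" for m unfolding r_def by (rule Max_ge[OF frange]) auto
    \<comment> \<open>A stage at which the set is complete and contains the supposedly bad value
      \<open>h w\<close>.\<close>
    define m1 where "m1 = max m0 m'"
    have m1: "card (W m1) = r"
      using card_mono[OF fin W_mono, of m' m1] m' le_r[of m1] by (simp add: m1_def)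
    have hW: "h w \<in> W m1" using bad hk W_mono[of m0 m1] by (auto simp: W_def m1_def)
    define s where "s = card {i \<in> W m1. i < h w}"
    have "s < r" unfolding s_def m1[symmetric]
      by (rule psubset_card_mono) (use hW fin in auto)
    have "r < N" using small m1 by (auto simp: W_def)
    have C_hw: "C w z m1 (h w)" using hW unfolding W_def by blast
    have rew: "{i. i < a \<and> (i < k w z \<and> C w z m i)} = {i \<in> W m. i < a}" for a m
      by (auto simp: W_def)
    have "P r s w (pr (h w) (pr z m1))"
      unfolding P_def prod_encode_inverse fst_conv snd_conv rew W_def[symmetric]
      using Gz(1) hk m1 s_def C_hw by blast
    then have "P r s w (LEAST y. P r s w y)" by (rule LeastI)
    then obtain y where y: "y = (LEAST y. P r s w y)" "P r s w y" by blast
    have z: "p1 (p2 y) = z" using y(2) Gz(2) unfolding P_def by blast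
    define m where "m = p2 (p2 y)"
    have iW: "p1 y \<in> W m" and rm: "r \<le> card (W m)" and sm: "card {i \<in> W m. i < p1 y} = s"
      using y(2) unfolding P_def z m_def[symmetric] rew unfolding W_def by blast+
    \<comment> \<open>A stage with \<open>r\<close> elements already shows the whole set, so rank
      \<open>s\<close> determines the candidate: it is \<open>h w\<close>, the value that
      \<open>h\<close> avoids.\<close>
    have "W m = W m1"
    proof (cases "m \<le> m1")
      case True
      then show ?thesis using card_seteq[OF fin W_mono] rm m1 by simp
    next
      case False
      then have "m1 \<le> m" by simp
      then show ?thesis using card_seteq[OF fin W_mono] le_r[of m] m1 by metis
    qed
    then have "p1 y = h w"
      using rank_inj[of "p1 y" "W m1" "h w"] iW hW sm by (simp add: s_def)
    moreover have "h w \<noteq> p1 y"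
      unfolding y(1) by (rule hP) (use \<open>s < r\<close> \<open>r < N\<close> y(2) in auto)
    ultimately show False by simp
  qed
  then show ?thesis using h by blast
qed

text \<open>At each level \<open>avoid_small\<close> picks a child that is never heavy; induction
  continues below it until the leaf itself is never bad.\<close>

lemma avoid_path:
  assumes g: "DNC (jump {}) g" "computable_from A g"
    and "decidable_from (jump {}) (\<lambda>u. G (p1 u) (p2 u))"
    and "computable_from (jump {}) (\<lambda>u. k (p1 u) (p2 u))"
    and "computable_from (jump {}) (\<lambda>u. t (p1 u) (p2 u))"
    and "decidable_from (jump {}) (\<lambda>u. B (p1 u) (p1 (p2 u)) (p1 (p2 (p2 u))) (p2 (p2 (p2 u))))"
    and "\<And>w z m m' x. B w z m x \<Longrightarrow> m \<le> m' \<Longrightarrow> B w z m' x"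
  shows "\<exists>V. computable_from A V \<and> (\<forall>w z. G w z \<longrightarrow> (\<forall>z'. G w z' \<longrightarrow> z' = z) \<longrightarrow>
    mx D (V w) < k w z \<longrightarrow> (\<forall>m. \<not> heavy (B w z m) N (k w z) D (t w z)) \<longrightarrow>
    (\<forall>m. \<not> B w z m (elem D (t w z) (V w))))"
  using assms(3-)
proof (induction D arbitrary: G k t B)
  case 0
  \<comment> \<open>At depth 0 the hypothesis about \<open>heavy\<close> is already the conclusion,
    so any \<open>V\<close> works.\<close>
  show ?case
    by (intro exI[of _ "\<lambda>_. 0"] conjI cf_const) (unfold heavy.simps elem.simps, blast)
next
  case (Suc D)
  note G = Suc.prems(1) and k = Suc.prems(2) and t = Suc.prems(3) and B = Suc.prems(4) and mono = Suc.prems(5)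
  have B': "decidable_from (jump {}) (\<lambda>x. B (a x) (b x) (c x) (d x))"
    if "computable_from (jump {}) a" "computable_from (jump {}) b" "computable_from (jump {}) c"
      "computable_from (jump {}) d" for a b c d
    using dec_comp[OF B cf_pair[OF that(1) cf_pair[OF that(2) cf_pair[OF that(3,4)]]]] by simp
  define C where "C w z m i = heavy (B w z m) N (k w z) D (sq (t w z) i)" for w z m i
  have C: "decidable_from (jump {}) (\<lambda>u. C (p1 u) (p1 (p2 u)) (p1 (p2 (p2 u))) (p2 (p2 (p2 u))))"
    unfolding C_def
  proof (rule dec_heavy)
    show "decidable_from (jump {}) (\<lambda>z. B (p1 (p1 z)) (p1 (p2 (p1 z))) (p1 (p2 (p2 (p1 z)))) (p2 z))"
      by (rule B'; intro cf_basic)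
    show "computable_from (jump {}) (\<lambda>u. k (p1 u) (p1 (p2 u)))"
      by (rule cf_comp2[OF k]; intro cf_basic)
    show "computable_from (jump {}) (\<lambda>u. sq (t (p1 u) (p1 (p2 u))) (p2 (p2 (p2 u))))"
      by (rule cf_sq; (rule cf_comp2[OF t])?; intro cf_basic)
  qed
  have C_mono: "C w z m' i" if "C w z m i" "m \<le> m'" for w z m m' i
    using that(1) unfolding C_def by (rule heavy_mono) (rule mono[OF _ that(2)])
  have "\<exists>h. computable_from A h \<and> (\<forall>w z m. G w z \<longrightarrow> (\<forall>z'. G w z' \<longrightarrow> z' = z) \<longrightarrow>
    (\<forall>m. card {i. i < k w z \<and> C w z m i} < N) \<longrightarrow> h w < k w z \<longrightarrow> \<not> C w z m (h w))"
    by (rule avoid_small[OF g G k C], rule C_mono)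
  then obtain h where h: "computable_from A h" "\<And>w z m. G w z \<Longrightarrow> (\<forall>z'. G w z' \<longrightarrow> z' = z) \<Longrightarrow>
    (\<forall>m. card {i. i < k w z \<and> C w z m i} < N) \<Longrightarrow> h w < k w z \<Longrightarrow> \<not> C w z m (h w)"
    by blast
  \<comment> \<open>The rest of the path depends on the child already chosen; \<open>w\<close> now
    codes the old parameter together with that child.\<close>
  have "\<exists>V. computable_from A V \<and> (\<forall>w z. G (p1 w) z \<longrightarrow> (\<forall>z'. G (p1 w) z' \<longrightarrow> z' = z) \<longrightarrow>
    mx D (V w) < k (p1 w) z \<longrightarrow> (\<forall>m. \<not> heavy (B (p1 w) z m) N (k (p1 w) z) D (sq (t (p1 w) z) (p2 w))) \<longrightarrow>
    (\<forall>m. \<not> B (p1 w) z m (elem D (sq (t (p1 w) z) (p2 w)) (V w))))"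
  proof (rule Suc.IH[of "\<lambda>w. G (p1 w)" "\<lambda>w. k (p1 w)" "\<lambda>w z. sq (t (p1 w) z) (p2 w)" "\<lambda>w. B (p1 w)"])
    show "decidable_from (jump {}) (\<lambda>u. G (p1 (p1 u)) (p2 u))"
      by (intro dec_comp2[OF G] cf_basic)
    show "computable_from (jump {}) (\<lambda>u. k (p1 (p1 u)) (p2 u))"
      by (intro cf_comp2[OF k] cf_basic)
    show "computable_from (jump {}) (\<lambda>u. sq (t (p1 (p1 u)) (p2 u)) (p2 (p1 u)))"
      by (intro cf_sq cf_comp2[OF t] cf_basic)
    show "decidable_from (jump {}) (\<lambda>u. B (p1 (p1 u)) (p1 (p2 u)) (p1 (p2 (p2 u))) (p2 (p2 (p2 u))))"
      by (intro B' cf_basic)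
    show "B (p1 w) z m x \<Longrightarrow> m \<le> m' \<Longrightarrow> B (p1 w) z m' x" for w z m m' x
      by (rule mono)
  qed
  then obtain V where V: "computable_from A V"
    "\<And>w z m. G (p1 w) z \<Longrightarrow> (\<forall>z'. G (p1 w) z' \<longrightarrow> z' = z) \<Longrightarrow>
      mx D (V w) < k (p1 w) z \<Longrightarrow> (\<forall>m. \<not> heavy (B (p1 w) z m) N (k (p1 w) z) D (sq (t (p1 w) z) (p2 w))) \<Longrightarrow>
      \<not> B (p1 w) z m (elem D (sq (t (p1 w) z) (p2 w)) (V w))" by blast
  have "computable_from A (\<lambda>w. pr (h w) (V (pr w (h w))))"
    by (intro cf_pair h cf_comp[OF V(1)] cf_id)
  moreover have "\<not> B w z m (elem (Suc D) (t w z) (pr (h w) (V (pr w (h w)))))"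
    if *: "G w z" "\<forall>z'. G w z' \<longrightarrow> z' = z" "mx (Suc D) (pr (h w) (V (pr w (h w)))) < k w z"
      "\<forall>m. \<not> heavy (B w z m) N (k w z) (Suc D) (t w z)" for w z m
  proof -
    have "h w < k w z" "mx D (V (pr w (h w))) < k w z"
      using *(3) unfolding mx.simps prod_encode_inverse fst_conv snd_conv by linarith+
    moreover have "\<forall>m. card {i. i < k w z \<and> C w z m i} < N" using *(4) unfolding heavy.simps not_le C_def .
    ultimately have "\<not> C w z m (h w)" for m using h(2) *(1,2) by blast
    then have "\<forall>m. \<not> heavy (B w z m) N (k w z) D (sq (t w z) (h w))" unfolding C_def by blast
    then have "\<not> B w z m (elem D (sq (t w z) (h w)) (V (pr w (h w))))"
      using V(2)[of "pr w (h w)" z m, unfolded prod_encode_inverse fst_conv snd_conv]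
        *(1,2) \<open>mx D (V (pr w (h w))) < k w z\<close> by blast
    then show ?thesis by (simp only: elem.simps prod_encode_inverse fst_conv snd_conv not_False_eq_True)
  qed
  ultimately show ?case by blast
qed

section \<open>Homogeneous sets in a reservoir\<close>

text \<open>The assumptions \<open>avail\<close> and \<open>nobad\<close> are the two properties
  delivered by \<open>nest_dichotomy\<close>.\<close>

locale reservoir =
  fixes F :: "nat \<Rightarrow> nat \<Rightarrow> nat" and X :: "nat set" and D N e :: nat
    and g :: "nat \<Rightarrow> nat" and A :: "nat set"
  assumes F_cf: "computable_from {} (\<lambda>z. F (p1 z) (p2 z))"
    and X: "cset X"
    and avail: "Y \<subseteq> X \<Longrightarrow> cset Y \<Longrightarrow> \<exists>t. nest F K e D t \<and> els K D t \<subseteq> Y"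
    and nobad: "Y \<subseteq> X \<Longrightarrow> cset Y \<Longrightarrow> nest F N e D t \<Longrightarrow> els N D t \<subseteq> X \<Longrightarrow>
      \<exists>x\<in>els N D t. infinite {y \<in> Y. F x y = e}"
    and DNC: "DNC (jump {}) g"
    and g_cf: "computable_from A g"
begin

text \<open>A state \<open>pr n s\<close> codes the finite set of the first \<open>n\<close> entries of the sequence \<open>s\<close>.\<close>

definition R :: "nat \<Rightarrow> nat set" where
  "R a = {y \<in> X. \<forall>i<p1 a. sq (p2 a) i < y \<and> F (sq (p2 a) i) y = e}"

definition ext :: "nat \<Rightarrow> nat \<Rightarrow> nat" where
  "ext a x = pr (Suc (p1 a)) (pr x (p2 a))"

lemma R_subset: "R a \<subseteq> X"
  by (auto simp: R_def)

lemma R_ext: "R (ext a x) = {y \<in> R a. x < y \<and> F x y = e}"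
  unfolding R_def ext_def by (auto simp: All_less_Suc2)

lemma infinite_R_ext:
  assumes "infinite {y \<in> R a. F x y = e}"
  shows "infinite (R (ext a x))"
proof
  assume "finite (R (ext a x))"
  moreover have "{y \<in> R a. F x y = e} \<subseteq> R (ext a x) \<union> {..x}"
    by (auto simp: R_ext)
  ultimately show False using assms by (meson finite_Un finite_atMost finite_subset)
qed

lemma F_dec: "computable_from B a \<Longrightarrow> computable_from B b \<Longrightarrow> computable_from B (\<lambda>x. F (a x) (b x))"
  by (rule cf_comp2[OF cf_empty[OF F_cf]])

lemma dec_R:
  assumes "computable_from B a" "computable_from B b"
  shows "decidable_from B (\<lambda>x. b x \<in> R (a x))"
proof -
  have "decidable_from B (\<lambda>x. b x \<in> X)"
    by (rule dec_comp[OF cf_empty assms(2)]) (use X in \<open>simp add: cset_def\<close>)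
  moreover have "decidable_from B (\<lambda>x. \<forall>i<p1 (a x). sq (p2 (a x)) i < b x \<and> F (sq (p2 (a x)) i) (b x) = e)"
    by (intro dec_ball dec_and dec_less dec_eq F_dec cf_sq cf_basic cf_comp[OF assms(1)] cf_comp[OF assms(2)] assms)
  ultimately show ?thesis unfolding R_def mem_Collect_eq by (rule dec_and)
qed

lemma cset_R: "infinite (R a) \<Longrightarrow> cset (R a)"
  unfolding cset_def using dec_R[OF cf_const cf_id] by simp

definition solvable :: bool where
  "solvable \<longleftrightarrow> (\<exists>H. infinite H \<and> (\<forall>x\<in>H. \<forall>y\<in>H. x < y \<longrightarrow> F x y = e) \<and> decidable_from A (\<lambda>x. x \<in> H))"

text \<open>Each element chosen lies in the current reservoir and leaves infinitely many
  \<open>e\<close>-neighbours in it, so the construction never stops. The choices increase, which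
  makes their range decidable.\<close>

lemma greedy:
  assumes C: "decidable_from A (\<lambda>z. C (p1 z) (p2 z))"
    and c: "computable_from A (\<lambda>z. c (p1 z) (p2 z))"
    and ex: "\<And>a. infinite (R a) \<Longrightarrow> \<exists>z. C a z"
    and step: "\<And>a z. infinite (R a) \<Longrightarrow> C a z \<Longrightarrow> c a z \<in> R a \<and> infinite {y \<in> R a. F (c a z) y = e}"
  shows solvable
proof -
  define nxt where "nxt a z = ext a (c a z)" for a z
  define s where "s k = ((\<lambda>a. nxt a (LEAST z. C a z)) ^^ k) (pr 0 0)" for k
  have nxt: "computable_from A (\<lambda>z. nxt (p1 z) (p2 z))"
    unfolding nxt_def ext_def by (intro cf_basic c)
  have R0: "infinite (R (pr 0 0))"
    using X by (simp add: R_def cset_def)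
  have step': "infinite (R (nxt a (LEAST z. C a z)))" if "infinite (R a)" for a
    unfolding nxt_def by (intro infinite_R_ext) (use step[OF that LeastI_ex[OF ex[OF that]]] in blast)
  note it = cf_iterate[where good = "\<lambda>a. infinite (R a)" and C = C and nxt = nxt and start = "pr 0 0", OF C nxt R0 ex step']
  have s_cf: "computable_from A s" and s_inf: "infinite (R (s k))" for k
    using it unfolding s_def by blast+
  define h where "h k = c (s k) (LEAST z. C (s k) z)" for k
  have s_Suc: "s (Suc k) = ext (s k) (h k)" for k
    by (simp add: s_def h_def nxt_def)
  have hR: "h k \<in> R (s k)" for k
    unfolding h_def using step[OF s_inf LeastI_ex[OF ex[OF s_inf]]] by blast
  \<comment> \<open>Earlier choices are never dropped: \<open>ext\<close> puts the newest at index 0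
    and shifts the others.\<close>
  have hist: "\<exists>i<p1 (s k). sq (p2 (s k)) i = h j" if "j < k" for j k
    using that
  proof (induction k)
    case (Suc k)
    show ?case
    proof (cases "j = k")
      case True
      then show ?thesis by (intro exI[of _ 0]) (simp add: s_Suc ext_def)
    next
      case False
      then obtain i where "i < p1 (s k)" "sq (p2 (s k)) i = h j" using Suc by auto
      then show ?thesis by (intro exI[of _ "Suc i"]) (simp add: s_Suc ext_def)
    qed
  qed simp
  have h_less: "h j < h k" and h_col: "F (h j) (h k) = e" if "j < k" for j k
    using hist[OF that] hR[of k] unfolding R_def by auto
  have mono: "strict_mono h" using h_less by (simp add: strict_mono_def)
  \<comment> \<open>Reading \<open>h k\<close> off the next state avoids a further search, since
    \<open>s\<close> is already known to be computable.\<close>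
  have h_eq: "h = (\<lambda>k. sq (p2 (s (Suc k))) 0)"
    unfolding s_Suc ext_def by simp
  have h_cf: "computable_from A h"
    unfolding h_eq by (rule cf_sq[OF cf_snd[OF cf_comp[OF s_cf cf_Suc[OF cf_id]]] cf_const])
  \<comment> \<open>A strictly increasing \<open>h\<close> satisfies \<open>k \<le> h k\<close>, so
    only \<open>k \<le> x\<close> need be checked.\<close>
  have mem: "x \<in> range h \<longleftrightarrow> (\<exists>k<Suc x. h k = x)" for x
    using strict_mono_imp_increasing[OF mono] by (auto simp: less_Suc_eq_le)
  have "decidable_from A (\<lambda>x. x \<in> range h)"
    unfolding mem by (intro dec_bex dec_eq cf_comp[OF h_cf] cf_basic)
  moreover have "infinite (range h)"
    using mono by (simp add: finite_image_iff strict_mono_imp_inj_on)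
  moreover have "F x y = e" if xy: "x \<in> range h" "y \<in> range h" "x < y" for x y
  proof -
    obtain j k where jk: "x = h j" "y = h k" using xy by blast
    then have "j < k" using \<open>x < y\<close> strict_mono_less[OF mono] by simp
    then show ?thesis using h_col jk by simp
  qed
  ultimately show ?thesis unfolding solvable_def by blast
qed


section \<open>Events and the nests found after them\<close>

definition within :: "nat \<Rightarrow> nat \<Rightarrow> nat \<Rightarrow> bool" where
  "within a n t \<longleftrightarrow> nest F (Suc n) e D t \<and> (\<forall>y\<in>els (Suc n) D t. y \<in> R a)"

text \<open>Taking the least \<open>n\<close> and the least \<open>t\<close> makes the pair unique,
  as \<open>avoid_path\<close> requires.\<close>

definition first :: "(nat \<Rightarrow> nat \<Rightarrow> bool) \<Rightarrow> nat \<Rightarrow> nat \<Rightarrow> nat \<Rightarrow> nat \<Rightarrow> bool" where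
  "first E a i n t \<longleftrightarrow> E i n \<and> (\<forall>n'<n. \<not> E i n') \<and> within a n t \<and> (\<forall>t'<t. \<not> within a n t')"

lemma dec_within:
  assumes "computable_from B a" "computable_from B n" "computable_from B t"
  shows "decidable_from B (\<lambda>u. within (a u) (n u) (t u))"
  unfolding within_def
  by (intro dec_and dec_nest dec_els_ball dec_R cf_empty[OF F_cf] cf_basic assms cf_comp[OF assms(1)])

lemma dec_first:
  assumes E: "decidable_from B (\<lambda>z. E (p1 z) (p2 z))"
    and "computable_from B a" "computable_from B i" "computable_from B n" "computable_from B t"
  shows "decidable_from B (\<lambda>u. first E (a u) (i u) (n u) (t u))"
  unfolding first_def
  by (intro dec_and dec_ball dec_not dec_within dec_comp2[OF E] cf_basic assms
      cf_comp[OF assms(2)] cf_comp[OF assms(3)] cf_comp[OF assms(4)])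

lemma first_unique:
  assumes "first E a i n t" "first E a i n' t'"
  shows "n' = n \<and> t' = t"
proof -
  have n: "n' = n" using assms unfolding first_def by (metis linorder_neqE_nat)
  have "t' = t" using assms unfolding first_def n by (metis linorder_neqE_nat)
  with n show ?thesis by blast
qed

lemma first_exists:
  assumes "infinite (R a)" "E i n"
  shows "\<exists>n' t. E i n' \<and> first E a i n' t"
proof -
  define n' where "n' = (LEAST n. E i n)"
  have n': "E i n'" "\<forall>j<n'. \<not> E i j"
    unfolding n'_def using LeastI[of "E i", OF assms(2)] not_less_Least by blast+
  obtain t where "within a n' t"
    using avail[OF R_subset cset_R[OF assms(1)]] unfolding within_def by blast
  then have "within a n' (LEAST t. within a n' t)" "\<forall>t'<(LEAST t. within a n' t). \<not> within a n' t'"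
    using LeastI[of "within a n'"] not_less_Least by blast+
  with n' show ?thesis unfolding first_def by blast
qed

text \<open>By \<open>heavy_nest\<close>, a heavy nest would contain a nest of width
  \<open>N\<close> all of whose elements have their \<open>e\<close>-neighbours in
  \<open>R a\<close> below \<open>m\<close>, contrary to \<open>nobad\<close>.\<close>

lemma not_heavy:
  assumes "infinite (R a)" "within a n t"
  shows "\<not> heavy (\<lambda>x. \<not> (\<exists>y. m \<le> y \<and> y \<in> R a \<and> F x y = e)) N (Suc n) D t"
proof
  assume "heavy (\<lambda>x. \<not> (\<exists>y. m \<le> y \<and> y \<in> R a \<and> F x y = e)) N (Suc n) D t"
  then obtain u where u: "nest F N e D u"
    and els: "els N D u \<subseteq> els (Suc n) D t \<inter> {x. \<not> (\<exists>y. m \<le> y \<and> y \<in> R a \<and> F x y = e)}"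
    using assms(2) heavy_nest unfolding within_def by blast
  have "els N D u \<subseteq> X" using els assms(2) R_subset unfolding within_def by blast
  from nobad[OF R_subset cset_R[OF assms(1)] u this]
  obtain x where x: "x \<in> els N D u" "infinite {y \<in> R a. F x y = e}" by blast
  have "\<not> (\<exists>y. m \<le> y \<and> y \<in> R a \<and> F x y = e)" using els x(1) by blast
  then have "{y \<in> R a. F x y = e} \<subseteq> {..<m}" using not_le by blast
  with x(2) show False using finite_subset by blast
qed

text \<open>If an event \<open>E i n\<close> occurs, the width \<open>Suc n\<close> of the nest found next exceeds the choices \<open>V\<close>
  made in advance, unless \<open>n\<close> is bounded by these choices.\<close>

lemma phase:
  assumes EA: "decidable_from A (\<lambda>z. E (p1 z) (p2 z))"
    and EJ: "decidable_from (jump {}) (\<lambda>z. E (p1 z) (p2 z))"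
  shows "solvable \<or> decidable_from A (\<lambda>i. \<exists>n. E i n)"
proof -
  \<comment> \<open>The parameter \<open>w\<close> codes a state and an event index;
    \<open>z\<close> codes the stage of the event and the nest found.\<close>
  let ?G = "\<lambda>w z. first E (p1 w) (p2 w) (p1 z) (p2 z)"
  \<comment> \<open>Stage \<open>m\<close> of having only finitely many \<open>e\<close>-neighbours;
    monotone in \<open>m\<close> and decidable from the jump.\<close>
  let ?B = "\<lambda>w z m x. \<not> (\<exists>y. m \<le> y \<and> y \<in> R (p1 w) \<and> F x y = e)"
  have "decidable_from (jump {}) (\<lambda>u. ?G (p1 u) (p2 u))"
    by (intro dec_first[OF EJ] cf_basic)
  moreover have "computable_from (jump {}) (\<lambda>u. Suc (p1 (p2 u)))" 
    "computable_from (jump {}) (\<lambda>u. p2 (p2 u))"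
    by (intro cf_basic)+
  moreover have "decidable_from (jump {})
      (\<lambda>u. ?B (p1 u) (p1 (p2 u)) (p1 (p2 (p2 u))) (p2 (p2 (p2 u))))"
    by (intro dec_not dec_jump_ex dec_and dec_le dec_R dec_eq F_dec cf_basic)
  moreover have "?B w z m' x" if "?B w z m x" "m \<le> m'" for w z m m' x :: nat
    using that le_trans[of m m'] by blast
  ultimately obtain V where V: "computable_from A V"
    and avoid: "\<And>w z. ?G w z \<Longrightarrow> (\<forall>z'. ?G w z' \<longrightarrow> z' = z) \<Longrightarrow> mx D (V w) < Suc (p1 z) \<Longrightarrow>
      (\<forall>m. \<not> heavy (?B w z m) N (Suc (p1 z)) D (p2 z)) \<Longrightarrow> (\<forall>m. \<not> ?B w z m (elem D (p2 z) (V w)))"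
    using avoid_path[OF DNC g_cf, of ?G "\<lambda>w z. Suc (p1 z)" "\<lambda>w z. p2 z" ?B D N] by blast
  \<comment> \<open>Here \<open>z\<close> also codes the event index. The condition on
    \<open>mx\<close> says that the path fits into width \<open>Suc n\<close>, where
    \<open>n\<close> is the stage of the event.\<close>
  define C where "C a z \<longleftrightarrow> first E a (p1 z) (p1 (p2 z)) (p2 (p2 z)) \<and> mx D (V (pr a (p1 z))) \<le> p1 (p2 z)" for a z
  define c where "c a z = elem D (p2 (p2 z)) (V (pr a (p1 z)))" for a z
  have C_dec: "decidable_from A (\<lambda>z. C (p1 z) (p2 z))"
    unfolding C_def by (intro dec_and dec_first[OF EA] dec_le cf_mx cf_comp[OF V] cf_basic)
  have c_cf: "computable_from A (\<lambda>z. c (p1 z) (p2 z))"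
    unfolding c_def by (intro cf_elem cf_comp[OF V] cf_basic)
  have step: "c a z \<in> R a \<and> infinite {y \<in> R a. F (c a z) y = e}" if a: "infinite (R a)" and "C a z" for a z
  proof -
    let ?w = "pr a (p1 z)" and ?n = "p1 (p2 z)" and ?t = "p2 (p2 z)"
    have first: "first E a (p1 z) ?n ?t" and mx: "mx D (V ?w) < Suc ?n"
      using \<open>C a z\<close> unfolding C_def by auto
    have within: "within a ?n ?t" using first unfolding first_def by blast
    have "\<not> (\<exists>y. m \<le> y \<and> y \<in> R (p1 ?w) \<and> F (elem D ?t (V ?w)) y = e) \<Longrightarrow> False" for m
    proof -
      have "?G ?w (p2 z)" using first by simp
      moreover have "\<forall>z'. ?G ?w z' \<longrightarrow> z' = p2 z"
        using first_unique[OF first] by (auto intro: prod_decode_eq[THEN iffD1] prod_eqI)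
      moreover have "\<forall>m. \<not> heavy (?B ?w (p2 z) m) N (Suc ?n) D ?t"
        using not_heavy[OF a within] by simp
      ultimately show "\<not> (\<exists>y. m \<le> y \<and> y \<in> R (p1 ?w) \<and> F (elem D ?t (V ?w)) y = e) \<Longrightarrow> False"
        using avoid mx by blast
    qed
    then have "\<exists>y\<ge>m. y \<in> {y \<in> R a. F (c a z) y = e}" for m
      unfolding c_def by fastforce
    then have "infinite {y \<in> R a. F (c a z) y = e}"
      by (meson infinite_nat_iff_unbounded_le)
    moreover have "c a z \<in> R a"
      using within elem_in_els[OF mx] unfolding within_def c_def by blast
    ultimately show ?thesis by blast
  qed
  show ?thesis
  proof (cases "\<forall>a. infinite (R a) \<longrightarrow> (\<exists>z. C a z)")
    case True
    then show ?thesis using greedy[OF C_dec c_cf _ step] by blast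
  next
    case False
    then obtain a where a: "infinite (R a)" and none: "\<And>z. \<not> C a z" by blast
    \<comment> \<open>At the state \<open>a\<close> no nest is ever wide enough, so an event that
      occurs has its first stage below the largest index on the path chosen for it.\<close>
    have "(\<exists>n. E i n) \<longleftrightarrow> (\<exists>n<mx D (V (pr a i)). E i n)" for i
    proof
      assume "\<exists>n. E i n"
      then obtain n t where n: "E i n" and "first E a i n t"
        using first_exists[OF a, of E i] by blast
      then have "n < mx D (V (pr a i))"
        using none[of "pr i (pr n t)"] by (simp add: C_def not_le)
      with n show "\<exists>n<mx D (V (pr a i)). E i n" by blast
    qed blast
    moreover have "decidable_from A (\<lambda>i. \<exists>n<mx D (V (pr a i)). E i n)"
      by (intro dec_bex dec_comp2[OF EA] cf_mx cf_comp[OF V] cf_basic)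
    ultimately show ?thesis by simp
  qed
qed

lemma solvable: solvable
proof (rule ccontr)
  assume no: "\<not> solvable"
  \<comment> \<open>The index codes \<open>a\<close>, \<open>x\<close> and \<open>m\<close>; the
    event is an \<open>e\<close>-neighbour of \<open>x\<close> in \<open>R a\<close> from
    \<open>m\<close> on, and its stage is that neighbour.\<close>
  let ?E = "\<lambda>i n. p2 (p2 i) \<le> n \<and> n \<in> R (p1 i) \<and> F (p1 (p2 i)) n = e"
  have E: "decidable_from B (\<lambda>z. ?E (p1 z) (p2 z))" for B
    by (intro dec_and dec_le dec_R dec_eq F_dec cf_basic)
  \<comment> \<open>The index codes \<open>a\<close> and \<open>x\<close>; stage \<open>m\<close>
    certifies that no neighbour lies at or beyond \<open>m\<close>. The first use of
    \<open>phase\<close> makes this decidable from \<open>A\<close>.\<close>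
  let ?E' = "\<lambda>i m. \<not> (\<exists>n. ?E (pr (p1 i) (pr (p2 i) m)) n)"
  have D: "decidable_from A (\<lambda>i. \<exists>n. ?E i n)"
    using phase[OF E E] no by blast
  have EA: "decidable_from A (\<lambda>z. ?E' (p1 z) (p2 z))"
    by (rule dec_not, rule dec_comp[OF D]) (intro cf_basic)
  have EJ: "decidable_from (jump {}) (\<lambda>z. ?E' (p1 z) (p2 z))"
    by (rule dec_not, rule dec_comp[OF dec_jump_ex[OF E]]) (intro cf_basic)
  have bad: "decidable_from A (\<lambda>i. \<exists>m. ?E' i m)"
    using phase[OF EA EJ] no by blast
  have bad_iff: "(\<exists>m. ?E' (pr a x) m) \<longleftrightarrow> finite {y \<in> R a. F x y = e}" for a x
    unfolding finite_nat_iff_bounded by (auto simp: subset_eq not_le)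
  have "decidable_from A (\<lambda>z. p2 z \<in> R (p1 z) \<and> \<not> (\<exists>m. ?E' (pr (p1 z) (p2 z)) m))"
    by (intro dec_and dec_R dec_not dec_comp[OF bad] cf_basic)
  then have C: "decidable_from A (\<lambda>z. p2 z \<in> R (p1 z) \<and> infinite {y \<in> R (p1 z). F (p2 z) y = e})"
    unfolding bad_iff .
  \<comment> \<open>Any nest of width \<open>N\<close> inside \<open>R a\<close> has a suitable
    element by \<open>nobad\<close>, so a direct search for \<open>x\<close> ends.\<close>
  have "\<exists>x. x \<in> R a \<and> infinite {y \<in> R a. F x y = e}" if a: "infinite (R a)" for a
  proof -
    obtain t where t: "nest F N e D t" "els N D t \<subseteq> R a"
      using avail[OF R_subset cset_R[OF a]] by blast
    have "els N D t \<subseteq> X" using t(2) R_subset by blast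
    from nobad[OF R_subset cset_R[OF a] t(1) this] show ?thesis using t(2) by blast
  qed
  from greedy[OF C, of "\<lambda>a x. x", OF cf_snd[OF cf_id] this] no show False by blast
qed

end

section \<open>From the coloring to a reservoir\<close>

theorem theorem6p13:
  fixes l :: nat and \<pi> :: "nat \<Rightarrow> nat" and f :: "nat \<times> nat \<Rightarrow> nat" and d :: "nat set set"
  assumes "separable l \<pi>"
    and "computable_coloring f"
    and "avoids f l (perm_pattern \<pi>)"
    and "d \<in> turing_degrees"
    and "DNC_degree (jump {}) d"
  shows "\<exists>H. infinite H \<and> homogeneous f H \<and> degree_computes_set d H"
proof -
  obtain i where f01: "f \<in> pairs UNIV \<rightarrow> {..<2}"
    and "\<forall>z\<in>pairs UNIV. Phi {} i (prod_encode z) = Some (f z)"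
    using assms(2) unfolding computable_coloring_def by blast
  then have i: "run {} (program_of i) (pr x y) = Some (f (x, y))" if "x < y" for x y
    using that by (simp add: Phi_def pairs_def)
  \<comment> \<open>\<open>F\<close> must be total and computable, but \<open>f\<close> is
    controlled only on increasing pairs; the default \<open>Suc x\<close> keeps the query
    increasing.\<close>
  define F where "F x y = f (x, if x < y then y else Suc x)" for x y
  have F: "F x y = f (x, y)" if "x < y" for x y
    using that by (simp add: F_def)
  have "computable_from {} (\<lambda>z. pr (p1 z) (if p1 z < p2 z then p2 z else Suc (p1 z)))"
    by (intro cf_If dec_less cf_basic)
  then obtain q where "run {} q = (\<lambda>z. Some (pr (p1 z) (if p1 z < p2 z then p2 z else Suc (p1 z))))"
    unfolding computable_from_iff by blast
  then have "run {} (Comp (program_of i) q) = (\<lambda>z. Some (F (p1 z) (p2 z)))"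
    by (simp add: fun_eq_iff F_def i)
  then have F_cf: "computable_from {} (\<lambda>z. F (p1 z) (p2 z))"
    unfolding computable_from_iff by blast
  have F01: "F x y \<le> 1" for x y
  proof -
    have "(x, if x < y then y else Suc x) \<in> pairs UNIV" by (simp add: pairs_def)
    from funcset_mem[OF f01 this] show ?thesis by (simp add: F_def)
  qed
  obtain d0 where d0: "\<And>t. nest F 2 0 d0 t \<Longrightarrow> contains F l \<pi> (els 2 d0 t)"
    using separable_unavoidable[OF assms(1), of F] unfolding unavoidable_def by blast
  \<comment> \<open>A nest of this depth with binary branching would contain the avoided
    pattern.\<close>
  have none: "\<not> (\<exists>t. nest F 2 0 d0 t)"
    using d0 avoids_not_contains[OF assms(3) refl F] by blast
  obtain X D N e where X: "cset X"
    and avail: "\<And>Y K. Y \<subseteq> X \<Longrightarrow> cset Y \<Longrightarrow> \<exists>t. nest F K e D t \<and> els K D t \<subseteq> Y"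
    and nobad: "\<And>Y t. Y \<subseteq> X \<Longrightarrow> cset Y \<Longrightarrow> nest F N e D t \<Longrightarrow> els N D t \<subseteq> X \<Longrightarrow>
      \<exists>x\<in>els N D t. infinite {y \<in> Y. F x y = e}"
    by (rule nest_dichotomy[OF F_cf F01 none]) (rule that)
  obtain g A where g: "DNC (jump {}) g" "A \<in> d" "computable_from A g"
    using assms(5) unfolding DNC_degree_def degree_computes_def by blast
  interpret reservoir F X D N e g A
    by (rule reservoir.intro) (fact F_cf X avail nobad g)+
  obtain H where "infinite H" "\<forall>x\<in>H. \<forall>y\<in>H. x < y \<longrightarrow> F x y = e" "decidable_from A (\<lambda>x. x \<in> H)"
    using solvable unfolding solvable_def by blast
  moreover from this(2) have "homogeneous f H"
    unfolding homogeneous_def pairs_def using F by (intro exI[of _ e]) auto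
  ultimately show ?thesis
    using g(2) unfolding degree_computes_set_def degree_computes_def by blast
qed

end
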